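(* Let $W(x,t)=e^{-v(x,t)}\widetilde W(x)$ be an arbitrary $N\times N$ matrix weight of this form, where $v(x,t)$ is a scalar polynomial in $x$ of even degree with positive leading coefficient depending smoothly on a parameter $t\ge0$. Let $P(x,n)$ be the monic matrix valued orthogonal polynomials with respect to $W(\cdot,t)$, with three-term recurrence relation $xP(x,n)=P(x,n+1)+B(n)P(x,n)+C(n)P(x,n-1)$. Denote by $\dot{\ }$ the derivative with respect to $t$. Then the recurrence coefficients satisfy the deformation equations $$\dot B(n)=\left(\dot v(L)\right)_{-1}(n)-\left(\dot v(L)\right)_{-1}(n+1),$$ $$\dot C(n)=\left(\dot v(L)\right)_{-2}(n)-\left(\dot v(L)\right)_{-2}(n+1)+\left(\dot v(L)\right)_{-1}(n)\,B(n-1)-B(n)\left(\dot v(L)\right)_{-1}(n).$$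
   Context: A matrix weight is a positive definite $M_N(\mathbb{C})$-valued weight function supported in a (possibly infinite) interval of $\mathbb{R}$. With $\langle F,G\rangle=\int F(y)W(y,t)G(y)^*\,dy$, the monic matrix valued orthogonal polynomials $P(x,n)=x^nI+\cdots$ (which depend on $t$) satisfy $\langle P(\cdot,n),P(\cdot,m)\rangle=\mathcal{H}(n)\delta_{n,m}$ with $\mathcal{H}(n)$ positive definite. The coefficients $B(n),C(n)\in M_N(\mathbb{C})$, $n\in\mathbb{N}_0$, depend on $t$, and $C(0)=0$. Difference operators $\sum_jA_j(n)\delta^j$, with $A_j$ matrix valued sequences, act from the left on sequences by $(\delta^j\cdot F)(n)=F(n+j)$ and compose by $(A(n)\delta^i)(B(n)\delta^j)=A(n)B(n+i)\delta^{i+j}$; sequences are taken to be $0$ at negative integers. Here $L=\delta+B(n)+C(n)\delta^{-1}$, and for a scalar polynomial $q$ in $x$, $(q(L))_j(n)$ is the coefficient of $\delta^j$ in $q(L)=\sum_{j=-\deg q}^{\deg q}(q(L))_j(n)\,\delta^j$. $\dot v(L)$ is the polynomial $x\mapsto\partial_tv(x,t)$ evaluated at $L$.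
   Formalization: Adds the assumption that all moments of W(·,t) are continuous in t≥0; without it the claim fails, e.g. N=1, v=(1+(t-1)^4)x^4-(t-1)x^2, W̃=exp(x^4-|x|), where C(1) blows up as t decreases to 1. The even degree of v is read as independent of t. *)

theory Defs
  imports "HOL-Analysis.Analysis" "HOL-Computational_Algebra.Polynomial"
begin

type_synonym 'n cmat = "complex^'n^'n"

definition conj_transpose :: "'n::finite cmat \<Rightarrow> 'n cmat" where
  "conj_transpose A = (\<chi> i j. cnj (A $ j $ i))"

definition pos_def :: "'n::finite cmat \<Rightarrow> bool" where
  "pos_def A \<longleftrightarrow> conj_transpose A = A \<and>
     (\<forall>u. u \<noteq> 0 \<longrightarrow> 0 < Re (\<Sum>i\<in>UNIV. cnj (u $ i) * (A *v u) $ i))"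

text \<open>A weight is only evaluated on the interval \<open>I\<close> supporting it: all integrals below are
  taken over \<open>I\<close>. Finiteness of all moments is what makes the matrix valued inner product
  defined on all matrix polynomials.\<close>

definition matrix_weight :: "real set \<Rightarrow> (real \<Rightarrow> 'n::finite cmat) \<Rightarrow> bool" where
  "matrix_weight I W \<longleftrightarrow>
     is_interval I \<and> interior I \<noteq> {} \<and>
     (AE x in lborel. x \<in> I \<longrightarrow> pos_def (W x)) \<and>
     (\<forall>k::nat. set_integrable lborel I (\<lambda>x. x ^ k *\<^sub>R W x))"

definition deformed_weight ::
  "(real \<Rightarrow> real poly) \<Rightarrow> (real \<Rightarrow> 'n::finite cmat) \<Rightarrow> real \<Rightarrow> real \<Rightarrow> 'n cmat" where
  "deformed_weight v Wt t x = exp (- poly (v t) x) *\<^sub>R Wt x"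

text \<open>Smooth dependence of \<open>v\<close> on \<open>t\<close> does not make the moments of
  \<open>deformed_weight v Wt t\<close> continuous in \<open>t\<close>: on the whole line take
  \<open>v(x,t) = (1 + (t-1)^4) x^4 - (t-1) x^2\<close> and \<open>Wt(x) = exp(x^4 - |x|)\<close>; all moments
  are finite for every \<open>t\<close>, but \<open>C(1)\<close> tends to infinity as \<open>t\<close> decreases to 1.
  Continuity of the moments is therefore a separate condition. It is automatic if, for
  instance, \<open>Wt\<close> itself has finite moments or polynomial growth.\<close>

definition moment :: "real set \<Rightarrow> (real \<Rightarrow> 'n::finite cmat) \<Rightarrow> nat \<Rightarrow> 'n cmat" where
  "moment I W k = (LINT x:I|lborel. x ^ k *\<^sub>R W x)"

definition mip ::
  "real set \<Rightarrow> (real \<Rightarrow> 'n::finite cmat) \<Rightarrow> (real \<Rightarrow> 'n cmat) \<Rightarrow> (real \<Rightarrow> 'n cmat) \<Rightarrow> 'n cmat" where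
  "mip I W F G = (LINT y:I|lborel. F y ** W y ** conj_transpose (G y))"

definition monic_matrix_poly :: "nat \<Rightarrow> (real \<Rightarrow> 'n::finite cmat) \<Rightarrow> bool" where
  "monic_matrix_poly n F \<longleftrightarrow>
     (\<exists>A. A n = mat 1 \<and> (\<forall>x. F x = (\<Sum>k\<le>n. x ^ k *\<^sub>R A k)))"

definition monic_MVOP ::
  "real set \<Rightarrow> (real \<Rightarrow> 'n::finite cmat) \<Rightarrow> (nat \<Rightarrow> real \<Rightarrow> 'n cmat) \<Rightarrow> bool" where
  "monic_MVOP I W P \<longleftrightarrow>
     (\<forall>n. monic_matrix_poly n (P n)) \<and>
     (\<forall>n m. n \<noteq> m \<longrightarrow> mip I W (P n) (P m) = 0) \<and>
     (\<forall>n. pos_def (mip I W (P n) (P n)))"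

text \<open>Extension of a sequence by zero to the negative integers.\<close>

definition zext :: "(nat \<Rightarrow> 'a::zero) \<Rightarrow> int \<Rightarrow> 'a" where
  "zext f m = (if m < 0 then 0 else f (nat m))"

text \<open>The operator with coefficient \<open>A j n\<close> at \<open>\<delta>\<^sup>j\<close>; only
  finitely many of the sequences \<open>A j\<close> are nonzero.\<close>

type_synonym 'n diffop = "int \<Rightarrow> nat \<Rightarrow> 'n cmat"

definition op_id :: "'n::finite diffop" where
  "op_id j n = (if j = 0 then mat 1 else 0)"

text \<open>Composition obtained by bilinear extension of
  \<open>(A(n) \<delta>\<^sup>i) (B(n) \<delta>\<^sup>j) = A(n) B(n+i) \<delta>\<^sup>i\<^sup>+\<^sup>j\<close>.\<close>

definition op_comp :: "'n::finite diffop \<Rightarrow> 'n diffop \<Rightarrow> 'n diffop" where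
  "op_comp A B k n =
     (\<Sum>i | A i \<noteq> (\<lambda>_. 0). A i n ** zext (B (k - i)) (int n + i))"

definition op_poly :: "real poly \<Rightarrow> 'n::finite diffop \<Rightarrow> 'n diffop" where
  "op_poly q L j n = (\<Sum>k\<le>degree q. coeff q k *\<^sub>R (op_comp L ^^ k) op_id j n)"

definition Jacobi_op :: "(nat \<Rightarrow> 'n::finite cmat) \<Rightarrow> (nat \<Rightarrow> 'n cmat) \<Rightarrow> 'n diffop" where
  "Jacobi_op B C j =
     (if j = 1 then (\<lambda>n. mat 1) else if j = 0 then B else if j = -1 then C else (\<lambda>n. 0))"

text \<open>Smoothness on \<open>[0,\<infinity>)\<close>, with one-sided derivatives at \<open>0\<close>:
  \<open>g k\<close> is the \<open>k\<close>-th derivative.\<close>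

definition smooth_nonneg :: "(real \<Rightarrow> real) \<Rightarrow> bool" where
  "smooth_nonneg f \<longleftrightarrow>
     (\<exists>g :: nat \<Rightarrow> real \<Rightarrow> real. g 0 = f \<and>
        (\<forall>k. \<forall>t\<ge>0. (g k has_real_derivative g (Suc k) t) (at t within {0..})))"

definition poly_dot :: "(real \<Rightarrow> real poly) \<Rightarrow> real \<Rightarrow> real poly" where
  "poly_dot v t = (THE p. \<forall>x.
     ((\<lambda>s. poly (v s) x) has_real_derivative poly p x) (at t within {0..}))"

text \<open>\<open>poly_dot v t\<close> is well defined for a family of fixed degree whose coefficients
  depend differentiably on \<open>t\<close>.\<close>

lemma poly_dot_eqI:
  assumes t: "t \<ge> 0" and deg: "\<forall>s\<ge>0. degree (v s) = d" and p: "degree p \<le> d"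
    and c: "\<And>k. ((\<lambda>s. coeff (v s) k) has_real_derivative coeff p k) (at t within {0..})"
  shows "poly_dot v t = p"
  unfolding poly_dot_def
proof (rule the_equality)
  have "((\<lambda>s. poly (v s) x) has_real_derivative poly p x) (at t within {0..})" for x
  proof -
    have "((\<lambda>s. \<Sum>k\<le>d. coeff (v s) k * x ^ k) has_real_derivative (\<Sum>k\<le>d. coeff p k * x ^ k))
        (at t within {0..})"
      by (intro DERIV_sum DERIV_cmult_right c)
    moreover have "(\<Sum>k\<le>d. coeff p k * x ^ k) = poly p x"
      unfolding poly_altdef using p
      by (intro sum.mono_neutral_right) (auto simp: coeff_eq_0)
    ultimately show ?thesis
      using deg t
      by (auto simp: poly_altdef intro: has_field_derivative_transform_within[OF _ zero_less_one])
  qed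
  then show *: "\<forall>x. ((\<lambda>s. poly (v s) x) has_real_derivative poly p x) (at t within {0..})"
    by blast
  have nt: "at t within {0..} \<noteq> bot"
  proof -
    have "{0::real..} \<noteq> {x}" for x
    proof
      assume "{0::real..} = {x}"
      then have "0 \<in> {x}" "1 \<in> {x}" by (metis atLeast_iff order_refl, metis atLeast_iff zero_le_one)
      then show False by simp
    qed
    then have "t islimpt {0..}"
      using t by (intro connected_imp_perfect) auto
    then show ?thesis by (simp add: trivial_limit_within)
  qed
  fix q assume "\<forall>x. ((\<lambda>s. poly (v s) x) has_real_derivative poly q x) (at t within {0..})"
  then have "poly q x = poly p x" for x
    using * tendsto_unique[OF nt] unfolding has_field_derivative_iff by blast
  then show "q = p" by (intro iffD1[OF poly_eq_poly_eq_iff] ext)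
qed

end

theory Submission
  imports Defs
begin

text \<open>
  Write \<open>H m\<close> for the squared norm of \<open>P m\<close>, and \<open>V\<^sub>j(n)\<close> for the coefficients of \<open>\<partial>\<^sub>t v\<close> evaluated
  at \<open>L\<close>. The recurrence says that \<open>L\<close> acts on the sequence of orthogonal polynomials as multiplication
  by \<open>x\<close>, so \<open>\<partial>\<^sub>t v * P n\<close> is the sum of the \<open>V\<^sub>j(n) ** P (n + j)\<close>. Differentiating the orthogonality of
  \<open>P n\<close> and \<open>P m\<close> for \<open>m < n\<close> in \<open>t\<close>, where the weight contributes the factor \<open>- \<partial>\<^sub>t v\<close>, shows that the
  derivative of \<open>P n\<close> pairs with \<open>P m\<close> to \<open>V\<^sub>m\<^sub>-\<^sub>n(n) ** H m\<close>. Since this derivative has degree less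
  than \<open>n\<close>, it is the sum of the \<open>V\<^sub>m\<^sub>-\<^sub>n(n) ** P m\<close> over \<open>m < n\<close>
  (\<open>MVOP_coeff_has_vector_derivative\<close>). In particular the coefficients \<open>p n\<close> and \<open>q n\<close> of \<open>x\<^sup>n\<^sup>-\<^sup>1\<close> and
  \<open>x\<^sup>n\<^sup>-\<^sup>2\<close> in \<open>P n\<close> have the derivatives \<open>V\<^sub>-\<^sub>1(n)\<close> and
  \<open>V\<^sub>-\<^sub>2(n) + V\<^sub>-\<^sub>1(n) ** p (n - 1)\<close>. Comparing coefficients in the recurrence gives
  \<open>B n = p n - p (n + 1)\<close> and \<open>C n = q n - q (n + 1) - B n ** p n\<close>
  (\<open>B_eq_subleading\<close>, \<open>C_eq_subleading\<close>), and differentiating these two identities yields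
  the deformation equations.

  The analytic part is to justify the derivatives. The moments are differentiable because
  the error of the first order expansion of \<open>exp (- v)\<close> in \<open>t\<close> is bounded by the square of the increment
  of \<open>v\<close> times the sum of the two weights; its integral is controlled by traces of even moments, which
  are locally bounded by continuity of the moments (\<open>moment_has_vector_derivative\<close>). For the
  polynomials, comparing orthogonality at \<open>s\<close> and at \<open>t\<close> expresses the difference of the
  coefficients of \<open>P n\<close> at the two times through differences of moments and the coefficients at time \<open>s\<close>
  (\<open>MVOP_coeff_difference\<close>). Such a system forces boundedness, continuity and
  differentiability in turn (\<open>perturbed_linear_system_derivative\<close>).
\<close>

section \<open>Matrix algebra\<close>

interpretation cmat_mult: bounded_bilinear "(**) :: 'n::finite cmat \<Rightarrow> 'n cmat \<Rightarrow> 'n cmat"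
proof -
  have 1: "(r *\<^sub>R A) ** B = r *\<^sub>R (A ** B)" "A ** (r *\<^sub>R B) = r *\<^sub>R (A ** B)"
    for r and A B :: "'n cmat"
    by (simp_all add: matrix_matrix_mult_def vec_eq_iff scaleR_sum_right)
  have "bilinear ((**) :: 'n cmat \<Rightarrow> 'n cmat \<Rightarrow> 'n cmat)"
    unfolding bilinear_def
    by (auto intro!: linearI simp: 1 matrix_add_ldistrib)
      (simp add: matrix_matrix_mult_def vec_eq_iff sum.distrib distrib_right)
  then show "bounded_bilinear ((**) :: 'n cmat \<Rightarrow> 'n cmat \<Rightarrow> 'n cmat)"
    by (simp add: bilinear_conv_bounded_bilinear)
qed

lemma bounded_linear_conj_transpose: "bounded_linear (conj_transpose :: 'n::finite cmat \<Rightarrow> 'n cmat)"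
  by (intro linear_conv_bounded_linear[THEN iffD1] linearI)
    (auto simp: conj_transpose_def vec_eq_iff)

lemma conj_transpose_mult: "conj_transpose (A ** B) = conj_transpose B ** conj_transpose A"
  by (simp add: conj_transpose_def matrix_matrix_mult_def vec_eq_iff mult.commute)

lemma pos_def_right_inverse:
  assumes "pos_def H"
  obtains H' where "H ** H' = mat 1"
proof -
  have "u = 0" if "H *v u = 0" for u
    using assms that unfolding pos_def_def by fastforce
  then obtain H' where "H' ** H = mat 1"
    using matrix_left_invertible_ker[of H] by blast
  then show ?thesis
    using that matrix_left_right_inverse by blast
qed

text \<open>Since \<^term>\<open>re_trace\<close> is real linear and dominates the norm on positive definite matrices,
  integrals of the norm of the weight are controlled by traces of matrix moments.\<close>

definition re_trace :: "'n::finite cmat \<Rightarrow> real" where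
  "re_trace A = (\<Sum>i\<in>UNIV. Re (A $ i $ i))"

lemma bounded_linear_re_trace: "bounded_linear (re_trace :: 'n::finite cmat \<Rightarrow> real)"
  by (intro linear_conv_bounded_linear[THEN iffD1] linearI)
    (auto simp: re_trace_def sum.distrib sum_distrib_left)

lemma pos_def_diag_pos:
  assumes "pos_def A"
  shows "0 < Re (A $ i $ i)"
proof -
  have "0 < Re (\<Sum>k\<in>UNIV. cnj (axis i 1 $ k) * (A *v axis i 1) $ k)"
    using assms unfolding pos_def_def by (metis axis_eq_0_iff zero_neq_one)
  also have "(\<Sum>k\<in>UNIV. cnj (axis i 1 $ k) * (A *v axis i 1) $ k) = A $ i $ i"
    by (simp add: axis_def matrix_vector_mult_def if_distrib if_distribR cong: if_cong)
  finally show ?thesis .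
qed

text \<open>For a nonzero entry off the diagonal: testing positivity on the vector with entries \<open>z\<close> and \<open>1\<close> at \<open>i\<close> and \<open>j\<close>, where \<open>z\<close> is the
  unimodular number with \<open>cnj z * A $ i $ j = - norm (A $ i $ j)\<close>, gives
  \<open>2 * norm (A $ i $ j) < A $ i $ i + A $ j $ j\<close>.\<close>

lemma pos_def_entry_le_re_trace:
  fixes A :: "'n::finite cmat"
  assumes A: "pos_def A"
  shows "norm (A $ i $ j) \<le> re_trace A"
proof (cases "i = j")
  case True
  have "A $ i $ i = cnj (A $ i $ i)"
    using A unfolding pos_def_def conj_transpose_def by (metis (no_types, lifting) vec_lambda_beta)
  then have "Im (A $ i $ i) = 0" by (metis cnj.simps(2) equal_neg_zero)
  then have "norm (A $ i $ i) = Re (A $ i $ i)"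
    using pos_def_diag_pos[OF A, of i] by (simp add: cmod_def)
  also have "\<dots> \<le> re_trace A"
    unfolding re_trace_def by (rule member_le_sum) (auto intro: less_imp_le pos_def_diag_pos[OF A])
  finally show ?thesis using True by simp
next
  case False
  define z where "z = - sgn (A $ i $ j)"
  define u :: "complex^'n" where "u = (\<chi> k. if k = i then z else if k = j then 1 else 0)"
  show ?thesis
  proof (cases "A $ i $ j = 0")
    case True
    then show ?thesis using pos_def_diag_pos[OF A] by (simp add: re_trace_def less_imp_le sum_nonneg)
  next
    case nz: False
    have hj: "A $ j $ i = cnj (A $ i $ j)"
      using A unfolding pos_def_def conj_transpose_def by (metis (no_types, lifting) vec_lambda_beta)
    have u0: "u \<noteq> 0" using False by (auto simp: u_def vec_eq_iff intro!: exI[of _ j])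
    have S: "(\<Sum>k\<in>UNIV. f k * (u $ k)) = f i * z + f j" for f :: "'n \<Rightarrow> complex"
    proof -
      have "(\<Sum>k\<in>UNIV. f k * (u $ k)) = (\<Sum>k\<in>{i,j}. f k * (u $ k))"
        by (rule sum.mono_neutral_right) (auto simp: u_def)
      then show ?thesis using False by (simp add: u_def)
    qed
    have S': "(\<Sum>k\<in>UNIV. cnj (u $ k) * f k) = cnj z * f i + f j" for f :: "'n \<Rightarrow> complex"
    proof -
      have "(\<Sum>k\<in>UNIV. cnj (u $ k) * f k) = (\<Sum>k\<in>{i,j}. cnj (u $ k) * f k)"
        by (rule sum.mono_neutral_right) (auto simp: u_def)
      then show ?thesis using False by (simp add: u_def)
    qed
    have zz: "cnj z * z = 1"
    proof -
      have "norm z = 1" using nz by (simp add: z_def norm_sgn)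
      then show ?thesis by (metis mult.commute complex_norm_square of_real_1 one_power2)
    qed
    have za: "cnj z * (A $ i $ j) = - of_real (norm (A $ i $ j))"
    proof -
      have "cnj (A $ i $ j) * A $ i $ j = (of_real (norm (A $ i $ j)))\<^sup>2"
        by (metis complex_norm_square mult.commute of_real_power)
      then show ?thesis using nz
        by (simp add: z_def sgn_eq power2_eq_square divide_simps)
    qed
    then have az: "cnj (A $ i $ j) * z = - of_real (norm (A $ i $ j))"
      by (metis complex_cnj_cnj complex_cnj_complex_of_real complex_cnj_minus complex_cnj_mult mult.commute)
    have "0 < Re (\<Sum>k\<in>UNIV. cnj (u $ k) * (A *v u) $ k)"
      using A u0 unfolding pos_def_def by blast
    also have "(\<Sum>k\<in>UNIV. cnj (u $ k) * (A *v u) $ k) =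
        cnj z * (A $ i $ i * z + A $ i $ j) + (A $ j $ i * z + A $ j $ j)"
      by (simp add: S' matrix_vector_mult_def S)
    also have "\<dots> = (cnj z * z) * A $ i $ i + cnj z * A $ i $ j + cnj (A $ i $ j) * z + A $ j $ j"
      by (simp add: hj algebra_simps)
    also have "Re \<dots> = Re (A $ i $ i) + Re (A $ j $ j) - 2 * norm (A $ i $ j)"
      by (simp add: zz za az)
    finally have "2 * norm (A $ i $ j) \<le> Re (A $ i $ i) + Re (A $ j $ j)" by simp
    also have "\<dots> = (\<Sum>k\<in>{i,j}. Re (A $ k $ k))" using False by simp
    also have "\<dots> \<le> re_trace A"
      unfolding re_trace_def by (rule sum_mono2) (auto intro: less_imp_le pos_def_diag_pos[OF A])
    finally show ?thesis using norm_ge_zero[of "A $ i $ j"] by linarith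
  qed
qed

lemma pos_def_norm_le_re_trace:
  fixes A :: "'n::finite cmat"
  assumes A: "pos_def A"
  shows "norm A \<le> (real CARD('n))\<^sup>2 * re_trace A"
proof -
  have "norm A \<le> (\<Sum>i\<in>UNIV. norm (A $ i))"
    unfolding norm_vec_def by (rule L2_set_le_sum) simp
  also have "\<dots> \<le> (\<Sum>i\<in>UNIV. \<Sum>j\<in>UNIV. norm (A $ i $ j))"
    unfolding norm_vec_def[of "_ $ _"] by (intro sum_mono L2_set_le_sum) simp
  also have "\<dots> \<le> (\<Sum>i\<in>(UNIV::'n set). \<Sum>j\<in>(UNIV::'n set). re_trace A)"
    by (intro sum_mono pos_def_entry_le_re_trace A)
  finally show ?thesis by (simp add: power2_eq_square mult.assoc)
qed

section \<open>Difference quotients and perturbation of linear systems\<close>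

lemma has_vector_derivative_iff_quotient:
  "(f has_vector_derivative D) (at t within S) \<longleftrightarrow>
     ((\<lambda>s. (f s - f t) /\<^sub>R (s - t)) \<longlongrightarrow> D) (at t within S)" 
proof -
  have "(f has_vector_derivative D) (at t within S) \<longleftrightarrow>
     ((\<lambda>s. ((f s - f t) - (s - t) *\<^sub>R D) /\<^sub>R norm (s - t)) \<longlongrightarrow> 0) (at t within S)"
    by (simp add: has_vector_derivative_def has_derivative_within bounded_linear_scaleR_left
        inverse_eq_divide diff_diff_eq)
  also have "\<dots> \<longleftrightarrow> ((\<lambda>s. (f s - f t) /\<^sub>R (s - t) - D) \<longlongrightarrow> 0) (at t within S)"
    unfolding tendsto_norm_zero_iff[of "\<lambda>s. ((f s - f t) - (s - t) *\<^sub>R D) /\<^sub>R norm (s - t)", symmetric]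
      tendsto_norm_zero_iff[of "\<lambda>s. (f s - f t) /\<^sub>R (s - t) - D", symmetric]
  proof (rule filterlim_cong[OF refl refl])
    show "\<forall>\<^sub>F s in at t within S. norm (((f s - f t) - (s - t) *\<^sub>R D) /\<^sub>R norm (s - t))
        = norm ((f s - f t) /\<^sub>R (s - t) - D)"
      unfolding eventually_at_filter
    proof (intro always_eventually allI impI)
      fix s assume "s \<noteq> t"
      then have "(f s - f t) /\<^sub>R (s - t) - D = ((f s - f t) - (s - t) *\<^sub>R D) /\<^sub>R (s - t)"
        by (simp add: scaleR_diff_right)
      then show "norm (((f s - f t) - (s - t) *\<^sub>R D) /\<^sub>R norm (s - t))
        = norm ((f s - f t) /\<^sub>R (s - t) - D)"
        by simp
    qed
  qed
  also have "\<dots> \<longleftrightarrow> ((\<lambda>s. (f s - f t) /\<^sub>R (s - t)) \<longlongrightarrow> D) (at t within S)"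
    by (rule Lim_null[symmetric])
  finally show ?thesis .
qed

text \<open>The remainder of the first order expansion of \<open>exp (- a)\<close> at \<open>b\<close>. The bound has to hold for all
  \<open>a\<close> and \<open>b\<close>, since \<open>a - b = v(x,s) - v(x,t)\<close> is unbounded in \<open>x\<close>; the sum of the two exponentials
  on the right then turns into the sum of the weights at \<open>s\<close> and at \<open>t\<close>. After division by
  \<open>exp (- b)\<close> only \<open>y = b - a\<close> is left, and the claim becomes
  \<open>exp y * (1 - y\<^sup>2) \<le> 1 + y + y\<^sup>2\<close>: for \<open>y \<le> 1\<close> already \<open>exp y \<le> 1 + y + y\<^sup>2\<close>, and for
  \<open>\<bar>y\<bar> > 1\<close> the factor \<open>1 - y\<^sup>2\<close> is negative.\<close>

lemma exp_second_order_bound: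
  fixes a b :: real
  shows "\<bar>exp (- a) - exp (- b) + (a - b) * exp (- b)\<bar> \<le> (a - b)\<^sup>2 * (exp (- a) + exp (- b))"
proof -
  define y where "y = b - a"
  have up: "exp y * (1 - y\<^sup>2) \<le> 1 + y + y\<^sup>2"
  proof -
    consider "y < -1" | "-1 \<le> y" "y < 0" | "0 \<le> y" "y \<le> 1" | "1 < y" by linarith
    then show ?thesis
    proof cases
      case 1
      then have "1 < y\<^sup>2" using less_1_mult[of "- y" "- y"] by (simp add: power2_eq_square)
      then have "exp y * (1 - y\<^sup>2) \<le> 0" by (simp add: mult_nonneg_nonpos)
      moreover have "0 \<le> y * (y + 1)" using 1 by (intro mult_nonpos_nonpos) auto
      moreover have "1 + y + y\<^sup>2 = 1 + y * (y + 1)" by (simp add: algebra_simps power2_eq_square)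
      ultimately show ?thesis by linarith
    next
      case 2
      define z where "z = - y"
      have z: "0 < z" "z \<le> 1" using 2 by (auto simp: z_def)
      have "1 + z + z\<^sup>2 / 2 \<le> exp z" using z by (intro exp_lower_Taylor_quadratic) auto
      then have "1 \<le> (1 - z + z\<^sup>2) * exp z"
      proof -
        have "1 - z + z\<^sup>2 \<ge> 0" using z by simp
        then have "(1 - z + z\<^sup>2) * (1 + z + z\<^sup>2/2) \<le> (1 - z + z\<^sup>2) * exp z"
          using \<open>1 + z + z\<^sup>2 / 2 \<le> exp z\<close> by (rule mult_left_mono[rotated])
        moreover have "(1 - z + z\<^sup>2) * (1 + z + z\<^sup>2/2) = 1 + z\<^sup>2/2 + z^3/2 + z^4/2"
          by (simp add: field_simps power2_eq_square power3_eq_cube power4_eq_xxxx)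
        ultimately show ?thesis using z by (smt (verit) zero_le_power zero_le_power2 divide_nonneg_pos)
      qed
      then have "exp y \<le> 1 + y + y\<^sup>2"
        by (simp add: z_def exp_minus field_simps)
      moreover have "exp y * (1 - y\<^sup>2) \<le> exp y" by (simp add: algebra_simps)
      ultimately show ?thesis by linarith
    next
      case 3
      then have "exp y \<le> 1 + y + y\<^sup>2" by (rule exp_bound)
      moreover have "exp y * (1 - y\<^sup>2) \<le> exp y" by (simp add: algebra_simps)
      ultimately show ?thesis by linarith
    next
      case 4
      then have "1 < y\<^sup>2" by simp
      then have "exp y * (1 - y\<^sup>2) \<le> 0" by (simp add: mult_nonneg_nonpos)
      then show ?thesis using 4 by (smt (verit) zero_le_power2)
    qed
  qed
  have ea: "exp (- a) = exp (- b) * exp y" by (simp add: y_def mult_exp_exp)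
  have "exp (- a) - exp (- b) + (a - b) * exp (- b) = exp (- b) * (exp y - 1 - y)"
    by (simp add: ea algebra_simps) (simp add: y_def algebra_simps)
  moreover have "0 \<le> exp y - 1 - y" using exp_ge_add_one_self[of y] by linarith
  moreover have "exp y - 1 - y \<le> y\<^sup>2 * (exp y + 1)" using up by (simp add: algebra_simps)
  ultimately have "\<bar>exp (- a) - exp (- b) + (a - b) * exp (- b)\<bar> \<le> exp (- b) * (y\<^sup>2 * (exp y + 1))"
    by simp
  also have "\<dots> = (a - b)\<^sup>2 * (exp (- a) + exp (- b))"
    by (simp add: ea y_def algebra_simps power2_commute)
  finally show ?thesis .
qed

text \<open>The system determines \<open>a s\<close> as a perturbation of \<open>a t\<close> with small coefficients \<open>G\<close>. The sum
  \<open>u\<close> of the norms of the unknowns satisfies \<open>u s \<le> u t + u s * g s\<close>, where \<open>g s\<close> tends to \<open>0\<close>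
  with the coefficients, so \<open>a s\<close> stays bounded
  near \<open>t\<close>; feeding this back into the system shows that \<open>a\<close> is continuous at \<open>t\<close>, and feeding
  continuity back once more shows that \<open>a\<close> is differentiable. This form suits orthogonal
  polynomials, about whose dependence on the parameter nothing is known beforehand.\<close>

lemma perturbed_linear_system_derivative:
  fixes a :: "real \<Rightarrow> nat \<Rightarrow> 'n::finite cmat" and G :: "nat \<Rightarrow> nat \<Rightarrow> real \<Rightarrow> 'n cmat"
  assumes eq: "\<And>s k. s \<in> S \<Longrightarrow> k \<le> n \<Longrightarrow> a s k = a t k + (\<Sum>i\<le>n. a s i ** G i k s)"
    and G0: "\<And>i k. G i k t = 0"
    and G': "\<And>i k. i \<le> n \<Longrightarrow> k \<le> n \<Longrightarrow> (G i k has_vector_derivative G' i k) (at t within S)"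
    and k: "k \<le> n" and t: "t \<in> S"
  shows "((\<lambda>s. a s k) has_vector_derivative (\<Sum>i\<le>n. a t i ** G' i k)) (at t within S)"
proof -
  define F where "F = at t within S"
  have step: "a s k - a t k = (\<Sum>i\<le>n. a s i ** G i k s)" if "s \<in> S" "k \<le> n" for s k
    using eq[OF that] by (simp only: diff_eq_eq add.commute)
  have inS: "\<forall>\<^sub>F s in F. s \<in> S" by (simp add: F_def eventually_at_filter)
  obtain c where c: "c \<ge> 0" "norm (X ** Y) \<le> norm X * norm Y * c" for X Y :: "'n cmat"
    using cmat_mult.nonneg_bounded by metis
  have Glim: "((\<lambda>s. G i k s) \<longlongrightarrow> 0) F" if "i \<le> n" "k \<le> n" for i k
    using has_vector_derivative_continuous[OF G'[OF that]] G0[of i k]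
    by (simp add: F_def continuous_within)
  define u where "u s = (\<Sum>k\<le>n. norm (a s k))" for s
  define g where "g s = (\<Sum>i\<le>n. \<Sum>k\<le>n. norm (G i k s)) * c" for s
  have "(g \<longlongrightarrow> (\<Sum>i\<le>n. \<Sum>k\<le>n. norm (0::'n cmat)) * c) F"
    unfolding g_def by (intro tendsto_intros tendsto_sum Glim) auto
  then have "(g \<longlongrightarrow> 0) F" by simp
  then have gsmall: "\<forall>\<^sub>F s in F. g s < 1/2" by (rule order_tendstoD) simp
  have u_le: "u s \<le> u t + u s * g s" if s: "s \<in> S" for s
  proof -
    have "u s \<le> (\<Sum>k\<le>n. norm (a t k) + (\<Sum>i\<le>n. norm (a s i) * norm (G i k s) * c))"
      unfolding u_def
    proof (intro sum_mono)
      fix k assume "k \<in> {..n}"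
      then have "norm (a s k) \<le> norm (a t k) + norm (\<Sum>i\<le>n. a s i ** G i k s)"
        using step[OF s, of k] norm_triangle_sub[of "a s k" "a t k"] by simp
      also have "norm (\<Sum>i\<le>n. a s i ** G i k s) \<le> (\<Sum>i\<le>n. norm (a s i) * norm (G i k s) * c)"
        by (intro sum_norm_le c(2))
      finally show "norm (a s k) \<le> norm (a t k) + (\<Sum>i\<le>n. norm (a s i) * norm (G i k s) * c)"
        by simp
    qed
    also have "\<dots> = u t + (\<Sum>i\<le>n. norm (a s i) * ((\<Sum>k\<le>n. norm (G i k s)) * c))"
      by (simp add: sum.distrib u_def sum_distrib_left sum_distrib_right mult.assoc) (rule sum.swap)
    also have "\<dots> \<le> u t + (\<Sum>i\<le>n. norm (a s i) * g s)"
      unfolding g_def using c(1)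
      by (intro add_left_mono sum_mono mult_left_mono mult_right_mono
          member_le_sum[where f = "\<lambda>i. \<Sum>k\<le>n. norm (G i k s)"] sum_nonneg) auto
    finally show ?thesis by (simp add: u_def sum_distrib_right)
  qed
  \<comment> \<open>Where \<open>g s < 1/2\<close>, the term \<open>u s * g s\<close> is absorbed on the left.\<close>
  have ubd: "\<forall>\<^sub>F s in F. u s \<le> 2 * u t"
    using gsmall inS
  proof eventually_elim
    case (elim s)
    have "u s * g s \<le> u s * (1/2)" using elim(1) by (intro mult_left_mono) (auto simp: u_def sum_nonneg)
    then show ?case using u_le[OF elim(2)] by simp
  qed
  have alim: "((\<lambda>s. a s k) \<longlongrightarrow> a t k) F" if k: "k \<le> n" for k
  proof (rule Lim_null[THEN iffD2], rule Lim_null_comparison)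
    show "\<forall>\<^sub>F s in F. norm (a s k - a t k) \<le> (\<Sum>i\<le>n. 2 * u t * norm (G i k s) * c)"
      using ubd inS
    proof eventually_elim
      case (elim s)
      have "norm (a s k - a t k) \<le> (\<Sum>i\<le>n. norm (a s i) * norm (G i k s) * c)"
        unfolding step[OF elim(2) k] by (intro sum_norm_le c(2))
      also have "\<dots> \<le> (\<Sum>i\<le>n. 2 * u t * norm (G i k s) * c)"
      proof (intro sum_mono mult_right_mono)
        fix i assume "i \<in> {..n}"
        then have "norm (a s i) \<le> u s" unfolding u_def by (intro member_le_sum) auto
        then show "norm (a s i) \<le> 2 * u t" using elim(1) by simp
      qed (use c in auto)
      finally show ?case .
    qed
    have "((\<lambda>s. \<Sum>i\<le>n. 2 * u t * norm (G i k s) * c) \<longlongrightarrow> (\<Sum>i\<le>n. 2 * u t * norm (0::'n cmat) * c)) F"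
      by (intro tendsto_intros Glim k) auto
    then show "((\<lambda>s. \<Sum>i\<le>n. 2 * u t * norm (G i k s) * c) \<longlongrightarrow> 0) F" by simp
  qed
  have "((\<lambda>s. \<Sum>i\<le>n. a s i ** ((G i k s - G i k t) /\<^sub>R (s - t))) \<longlongrightarrow> (\<Sum>i\<le>n. a t i ** G' i k)) F"
    using alim G'[OF _ k, unfolded has_vector_derivative_iff_quotient]
    unfolding F_def by (intro tendsto_sum cmat_mult.tendsto) auto
  then have "((\<lambda>s. (a s k - a t k) /\<^sub>R (s - t)) \<longlongrightarrow> (\<Sum>i\<le>n. a t i ** G' i k)) F"
  proof (rule Lim_transform_eventually)
    show "\<forall>\<^sub>F s in F. (\<Sum>i\<le>n. a s i ** ((G i k s - G i k t) /\<^sub>R (s - t))) = (a s k - a t k) /\<^sub>R (s - t)"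
      using inS
      by eventually_elim (use step[OF _ k] G0 in \<open>simp add: cmat_mult.scaleR_right scaleR_sum_right\<close>)
  qed
  then show ?thesis by (simp add: has_vector_derivative_iff_quotient F_def)
qed

section \<open>Matrix polynomials and the matrix valued inner product\<close>

definition mpoly :: "nat \<Rightarrow> (nat \<Rightarrow> 'n::finite cmat) \<Rightarrow> real \<Rightarrow> 'n cmat" where
  "mpoly n a x = (\<Sum>k\<le>n. x ^ k *\<^sub>R a k)"

lemma mpoly_add: "mpoly n a x + mpoly n b x = mpoly n (\<lambda>k. a k + b k) x"
  by (simp add: mpoly_def sum.distrib scaleR_add_right)

lemma mpoly_mult_left: "A ** mpoly n a x = mpoly n (\<lambda>k. A ** a k) x"
  by (simp add: mpoly_def cmat_mult.sum_right cmat_mult.scaleR_right)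

lemma mpoly_extend:
  assumes "n \<le> N" and "\<And>k. k > n \<Longrightarrow> a k = 0"
  shows "mpoly N a x = mpoly n a x"
  unfolding mpoly_def using assms by (intro sum.mono_neutral_right) auto

lemma mpoly_shift: "x *\<^sub>R mpoly n a x = mpoly (Suc n) (case_nat 0 a) x"
  unfolding mpoly_def by (subst sum.atMost_Suc_shift) (simp add: scaleR_sum_right)

lemma mpoly_coeffs_unique:
  fixes a b :: "nat \<Rightarrow> 'n::finite cmat"
  assumes eq: "\<And>x. mpoly n a x = mpoly n b x" and k: "k \<le> n"
  shows "a k = b k"
proof -
  have "Re (a k $ i $ j) = Re (b k $ i $ j) \<and> Im (a k $ i $ j) = Im (b k $ i $ j)" for i j
  proof -
    have e: "mpoly n a x $ i $ j = mpoly n b x $ i $ j" for x by (simp add: eq)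
    have "\<forall>x. (\<Sum>k\<le>n. Re (a k $ i $ j) * x ^ k) = (\<Sum>k\<le>n. Re (b k $ i $ j) * x ^ k)"
      using arg_cong[OF e, of Re] by (simp add: mpoly_def mult.commute)
    moreover have "\<forall>x. (\<Sum>k\<le>n. Im (a k $ i $ j) * x ^ k) = (\<Sum>k\<le>n. Im (b k $ i $ j) * x ^ k)"
      using arg_cong[OF e, of Im] by (simp add: mpoly_def mult.commute)
    ultimately show ?thesis using k unfolding polyfun_eq_coeffs by blast
  qed
  then show ?thesis by (simp add: vec_eq_iff complex_eq_iff)
qed

lemma bounded_linear_sandwich:
  fixes A B :: "'n::finite cmat"
  shows "bounded_linear (\<lambda>X. A ** X ** B)"
  by (intro bounded_linear_compose[OF cmat_mult.bounded_linear_left cmat_mult.bounded_linear_right])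

lemma conj_transpose_mpoly: "conj_transpose (mpoly m b y) = (\<Sum>l\<le>m. y ^ l *\<^sub>R conj_transpose (b l))"
  unfolding mpoly_def
  by (simp add: linear_sum[OF bounded_linear.linear[OF bounded_linear_conj_transpose]]
      linear_scale[OF bounded_linear.linear[OF bounded_linear_conj_transpose]])

lemma mpoly_mult_weight:
  fixes w :: "'n::finite cmat"
  shows
  "(y ^ r *\<^sub>R mpoly n a y) ** w ** conj_transpose (mpoly m b y) =
     (\<Sum>i\<le>n. \<Sum>l\<le>m. a i ** (y ^ (r + i + l) *\<^sub>R w) ** conj_transpose (b l))"
  unfolding conj_transpose_mpoly
  by (simp add: mpoly_def cmat_mult.sum_left cmat_mult.sum_right
      cmat_mult.scaleR_left cmat_mult.scaleR_right scaleR_sum_right power_add mult.commute mult.assoc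
      sum_distrib_left) (subst sum.swap, simp add: mult_ac)

context
  fixes I :: "real set" and W :: "real \<Rightarrow> 'n::finite cmat"
  assumes W: "matrix_weight I W"
begin

lemma integrable_moment: "integrable lborel (\<lambda>x. indicator I x *\<^sub>R (x ^ k *\<^sub>R W x))"
  using W by (simp add: matrix_weight_def set_integrable_def)

text \<open>The inner product of two matrix polynomials is a finite combination of moments: a matrix integral
  against fixed left and right factors is a bounded linear image of a moment.\<close>

lemma has_bochner_integral_mpoly:
  "has_bochner_integral lborel
     (\<lambda>y. indicator I y *\<^sub>R ((y ^ r *\<^sub>R mpoly n a y) ** W y ** conj_transpose (mpoly m b y)))
     (\<Sum>i\<le>n. \<Sum>l\<le>m. a i ** moment I W (r + i + l) ** conj_transpose (b l))"
proof -
  have "has_bochner_integral lborel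
     (\<lambda>y. \<Sum>i\<le>n. \<Sum>l\<le>m. a i ** (indicator I y *\<^sub>R (y ^ (r + i + l) *\<^sub>R W y)) ** conj_transpose (b l))
     (\<Sum>i\<le>n. \<Sum>l\<le>m. a i ** moment I W (r + i + l) ** conj_transpose (b l))"
    unfolding moment_def set_lebesgue_integral_def
    by (intro has_bochner_integral_sum has_bochner_integral_bounded_linear[OF bounded_linear_sandwich]
        has_bochner_integral_integrable integrable_moment)
  moreover have "(\<Sum>i\<le>n. \<Sum>l\<le>m. a i ** (indicator I y *\<^sub>R (y ^ (r + i + l) *\<^sub>R W y)) ** conj_transpose (b l)) =
      indicator I y *\<^sub>R ((y ^ r *\<^sub>R mpoly n a y) ** W y ** conj_transpose (mpoly m b y))" for y
    unfolding mpoly_mult_weight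
    by (simp only: cmat_mult.scaleR_left[of "indicator I y"] cmat_mult.scaleR_right[of _ "indicator I y"]
        scaleR_sum_right)
  ultimately show ?thesis by simp
qed

lemma mip_mpoly:
  "mip I W (\<lambda>y. y ^ r *\<^sub>R mpoly n a y) (mpoly m b) =
     (\<Sum>i\<le>n. \<Sum>l\<le>m. a i ** moment I W (r + i + l) ** conj_transpose (b l))"
  unfolding mip_def set_lebesgue_integral_def
  by (rule has_bochner_integral_integral_eq[OF has_bochner_integral_mpoly])

lemma integrable_mip:
  "integrable lborel (\<lambda>y. indicator I y *\<^sub>R (mpoly n a y ** W y ** conj_transpose (mpoly m b y)))"
  using has_bochner_integral_mpoly[of 0 n a m b] by (auto dest: integrable.intros)

end

lemma mip_sum_left:
  assumes W: "matrix_weight I W"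
    and F: "\<And>m. m \<in> M \<Longrightarrow> F m = mpoly (e m) (c m)" and G: "G = mpoly n b"
  shows "mip I W (\<lambda>x. \<Sum>m\<in>M. K m ** F m x) G = (\<Sum>m\<in>M. K m ** mip I W (F m) G)"
proof -
  have "mip I W (\<lambda>x. \<Sum>m\<in>M. K m ** F m x) G =
     (\<integral>y. (\<Sum>m\<in>M. K m ** (indicator I y *\<^sub>R (F m y ** W y ** conj_transpose (G y)))) \<partial>lborel)"
    unfolding mip_def set_lebesgue_integral_def
    by (simp add: cmat_mult.sum_left cmat_mult.scaleR_right scaleR_sum_right matrix_mul_assoc)
  also have "\<dots> = (\<Sum>m\<in>M. \<integral>y. K m ** (indicator I y *\<^sub>R (F m y ** W y ** conj_transpose (G y))) \<partial>lborel)"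
    by (intro Bochner_Integration.integral_sum integrable_bounded_linear[OF cmat_mult.bounded_linear_right])
      (simp add: F G integrable_mip[OF W])
  also have "\<dots> = (\<Sum>m\<in>M. K m ** mip I W (F m) G)"
    unfolding mip_def set_lebesgue_integral_def
    by (intro sum.cong refl integral_bounded_linear[OF cmat_mult.bounded_linear_right])
      (simp add: F G integrable_mip[OF W])
  finally show ?thesis .
qed

lemma mip_sum_right:
  assumes W: "matrix_weight I W"
    and F: "\<And>m. m \<in> M \<Longrightarrow> F m = mpoly (e m) (c m)" and G: "G = mpoly n b"
  shows "mip I W G (\<lambda>x. \<Sum>m\<in>M. K m ** F m x) = (\<Sum>m\<in>M. mip I W G (F m) ** conj_transpose (K m))"
proof -
  have "mip I W G (\<lambda>x. \<Sum>m\<in>M. K m ** F m x) =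
     (\<integral>y. (\<Sum>m\<in>M. (indicator I y *\<^sub>R (G y ** W y ** conj_transpose (F m y))) ** conj_transpose (K m)) \<partial>lborel)"
    unfolding mip_def set_lebesgue_integral_def
    by (simp add: linear_sum[OF bounded_linear.linear[OF bounded_linear_conj_transpose]]
        conj_transpose_mult cmat_mult.sum_right cmat_mult.scaleR_left scaleR_sum_right matrix_mul_assoc)
  also have "\<dots> = (\<Sum>m\<in>M. \<integral>y. (indicator I y *\<^sub>R (G y ** W y ** conj_transpose (F m y))) ** conj_transpose (K m) \<partial>lborel)"
    by (intro Bochner_Integration.integral_sum integrable_bounded_linear[OF cmat_mult.bounded_linear_left])
      (simp add: F G integrable_mip[OF W])
  also have "\<dots> = (\<Sum>m\<in>M. mip I W G (F m) ** conj_transpose (K m))"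
    unfolding mip_def set_lebesgue_integral_def
    by (intro sum.cong refl integral_bounded_linear[OF cmat_mult.bounded_linear_left])
      (simp add: F G integrable_mip[OF W])
  finally show ?thesis .
qed

section \<open>Coefficients of monic polynomials and orthogonal expansions\<close>

text \<open>A matrix polynomial is given as a function of \<open>x\<close>, so its coefficients are recovered by choice;
  \<open>mpoly_coeffs_unique\<close> shows that the choice is forced.\<close>

definition mcoeff :: "nat \<Rightarrow> (real \<Rightarrow> 'n::finite cmat) \<Rightarrow> nat \<Rightarrow> 'n cmat" where
  "mcoeff n F k =
     (if k \<le> n then (SOME A. A n = mat 1 \<and> (\<forall>x. F x = (\<Sum>k\<le>n. x ^ k *\<^sub>R A k))) k else 0)"

lemma
  assumes "monic_matrix_poly n F"
  shows mcoeff_lead: "mcoeff n F n = mat 1"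
    and mcoeff_mpoly: "F = mpoly n (mcoeff n F)"
proof -
  define A where "A = (SOME A. A n = mat 1 \<and> (\<forall>x. F x = (\<Sum>k\<le>n. x ^ k *\<^sub>R A k)))"
  have A: "A n = mat 1 \<and> (\<forall>x. F x = (\<Sum>k\<le>n. x ^ k *\<^sub>R A k))"
    unfolding A_def by (rule someI_ex[OF assms[unfolded monic_matrix_poly_def]])
  have "mcoeff n F k = (if k \<le> n then A k else 0)" for k by (simp add: mcoeff_def A_def)
  then show "mcoeff n F n = mat 1" "F = mpoly n (mcoeff n F)"
    using A by (auto simp: mpoly_def)
qed

lemma mcoeff_above: "n < k \<Longrightarrow> mcoeff n F k = 0"
  by (simp add: mcoeff_def)

lemma mcoeff_mpoly_extend:
  assumes "monic_matrix_poly n F" and "n \<le> N"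
  shows "F x = mpoly N (mcoeff n F) x"
proof -
  have "mpoly N (mcoeff n F) x = mpoly n (mcoeff n F) x"
    by (intro mpoly_extend assms(2) mcoeff_above)
  then show ?thesis
    unfolding mcoeff_mpoly[OF assms(1), symmetric] ..
qed

text \<open>Subtracting \<open>a N ** P N\<close> removes the leading term, because \<open>P N\<close> is monic.\<close>

lemma expansion_in_monic_polys:
  fixes P :: "nat \<Rightarrow> real \<Rightarrow> 'n::finite cmat" and a :: "nat \<Rightarrow> 'n cmat"
  assumes P: "\<And>n. monic_matrix_poly n (P n)"
  shows "\<exists>K. \<forall>x. (\<Sum>k<N. x ^ k *\<^sub>R a k) = (\<Sum>m<N. K m ** P m x)"
proof (induction N arbitrary: a)
  case 0
  show ?case by simp
next
  case (Suc N)
  define b where "b k = a k - a N ** mcoeff N (P N) k" for k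
  obtain K where K: "\<And>x. (\<Sum>k<N. x ^ k *\<^sub>R b k) = (\<Sum>m<N. K m ** P m x)" using Suc by blast
  have "(\<Sum>k<Suc N. x ^ k *\<^sub>R a k) = (\<Sum>m<Suc N. (K(N := a N)) m ** P m x)" for x
  proof -
    have "P N x = mpoly N (mcoeff N (P N)) x" using mcoeff_mpoly[OF P, of N] by metis
    also have "\<dots> = (\<Sum>k<N. x ^ k *\<^sub>R mcoeff N (P N) k) + x ^ N *\<^sub>R mat 1"
      by (simp add: mpoly_def lessThan_Suc_atMost[symmetric] mcoeff_lead[OF P])
    finally have "a N ** P N x = (\<Sum>k<N. x ^ k *\<^sub>R (a N ** mcoeff N (P N) k)) + x ^ N *\<^sub>R a N"
      by (simp add: cmat_mult.add_right cmat_mult.sum_right cmat_mult.scaleR_right)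
    moreover have "(\<Sum>m<N. (K(N := a N)) m ** P m x) = (\<Sum>k<N. x ^ k *\<^sub>R b k)"
      unfolding K by (intro sum.cong) auto
    ultimately show ?thesis
      by (simp add: b_def scaleR_diff_right sum_subtractf)
  qed
  then show ?case by blast
qed

context
  fixes I :: "real set" and W :: "real \<Rightarrow> 'n::finite cmat" and P :: "nat \<Rightarrow> real \<Rightarrow> 'n cmat"
  assumes W: "matrix_weight I W" and P: "monic_MVOP I W P"
begin

lemma MVOP_monic: "monic_matrix_poly n (P n)"
  using P by (simp add: monic_MVOP_def)

lemma MVOP_mpoly: "P n = mpoly n (mcoeff n (P n))"
  by (rule mcoeff_mpoly[OF MVOP_monic])

lemma MVOP_orthogonal: "n \<noteq> m \<Longrightarrow> mip I W (P n) (P m) = 0"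
  using P by (simp add: monic_MVOP_def)

lemma mip_MVOP_sum_left:
  assumes "finite M"
  shows "mip I W (\<lambda>x. \<Sum>m\<in>M. K m ** P m x) (P l) = (if l \<in> M then K l ** mip I W (P l) (P l) else 0)"
proof -
  have "mip I W (\<lambda>x. \<Sum>m\<in>M. K m ** P m x) (P l) = (\<Sum>m\<in>M. K m ** mip I W (P m) (P l))"
    by (rule mip_sum_left[OF W MVOP_mpoly MVOP_mpoly])
  also have "\<dots> = (\<Sum>m\<in>M. if m = l then K l ** mip I W (P l) (P l) else 0)"
    by (intro sum.cong) (auto simp: MVOP_orthogonal)
  finally show ?thesis using assms by (simp add: sum.delta)
qed

lemma MVOP_orthogonal_mpoly:
  assumes "m < n"
  shows "mip I W (P n) (mpoly m b) = 0"
proof -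
  obtain K where K: "\<forall>x. (\<Sum>k<Suc m. x ^ k *\<^sub>R b k) = (\<Sum>l<Suc m. K l ** P l x)"
    using expansion_in_monic_polys[OF MVOP_monic] by blast
  then have "mpoly m b = (\<lambda>x. \<Sum>l<Suc m. K l ** P l x)"
    by (simp add: mpoly_def fun_eq_iff lessThan_Suc_atMost)
  then have "mip I W (P n) (mpoly m b) = (\<Sum>l<Suc m. mip I W (P n) (P l) ** conj_transpose (K l))"
    by (simp only: mip_sum_right[OF W MVOP_mpoly MVOP_mpoly])
  also have "\<dots> = 0"
    by (rule sum.neutral) (use assms in \<open>auto simp: MVOP_orthogonal cmat_mult.zero_left\<close>)
  finally show ?thesis .
qed

end

section \<open>The moments are differentiable\<close>

lemma abs_power_le: "\<bar>x\<bar> ^ k \<le> (1 + x\<^sup>2) ^ k" for x :: real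
proof (rule power_mono)
  have "0 \<le> (\<bar>x\<bar> - 1)\<^sup>2 + \<bar>x\<bar>" by (simp add: add_nonneg_nonneg)
  then show "\<bar>x\<bar> \<le> 1 + x\<^sup>2" by (simp add: power2_diff)
qed simp

text \<open>The integral of \<open>(1 + x\<^sup>2)\<^sup>q\<close> times the trace of the weight, expanded by the binomial theorem: in this
  form its continuity in the parameter is inherited from the moments. The weight \<open>(1 + x\<^sup>2)\<^sup>q\<close> serves
  as an even majorant of \<open>\<bar>x\<bar>\<^sup>k\<close> for all \<open>k \<le> q\<close>.\<close>

definition even_trace_moment :: "real set \<Rightarrow> (real \<Rightarrow> 'n::finite cmat) \<Rightarrow> nat \<Rightarrow> real" where
  "even_trace_moment I W q = (\<Sum>i\<le>q. real (q choose i) * re_trace (moment I W (2 * i)))"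

lemma has_bochner_integral_even_trace_moment:
  assumes W: "matrix_weight I W"
  shows "has_bochner_integral lborel
    (\<lambda>x. indicator I x * ((1 + x\<^sup>2) ^ q * re_trace (W x))) (even_trace_moment I W q)"
proof -
  have "has_bochner_integral lborel
      (\<lambda>x. \<Sum>i\<le>q. real (q choose i) * re_trace (indicator I x *\<^sub>R (x ^ (2 * i) *\<^sub>R W x))) (even_trace_moment I W q)"
    unfolding even_trace_moment_def moment_def set_lebesgue_integral_def
    by (intro has_bochner_integral_sum has_bochner_integral_mult_right
        has_bochner_integral_bounded_linear[OF bounded_linear_re_trace]
        has_bochner_integral_integrable integrable_moment[OF W])
  moreover have "(\<Sum>i\<le>q. real (q choose i) * re_trace (indicator I x *\<^sub>R (x ^ (2 * i) *\<^sub>R W x)))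
      = indicator I x * ((1 + x\<^sup>2) ^ q * re_trace (W x))" for x
    by (simp add: linear_scale[OF bounded_linear.linear[OF bounded_linear_re_trace]] binomial_ring[of "x\<^sup>2" 1 q]
        sum_distrib_left sum_distrib_right power_mult[symmetric] mult_ac add.commute[of 1])
  ultimately show ?thesis by simp
qed

text \<open>Integrates \<open>exp_second_order_bound\<close> at \<open>a = v(x,s)\<close> and \<open>b = v(x,t)\<close> against \<open>x\<^sup>k\<close> times the undeformed
  weight. The quadratic factor satisfies
  \<open>\<bar>a - b\<bar> \<le> (\<Sum>j\<le>d. \<bar>\<Delta> j\<bar>) * (1 + x\<^sup>2)\<^sup>d\<close>, which
  together with \<open>\<bar>x\<bar>\<^sup>k\<close> explains the exponent \<open>k + 2 * d\<close>.\<close>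

lemma moment_second_order_bound:
  fixes I :: "real set" and Wt :: "real \<Rightarrow> 'n::finite cmat" and v :: "real \<Rightarrow> real poly"
  assumes deg: "degree (v s) = d" "degree (v t) = d"
    and Ws: "matrix_weight I (deformed_weight v Wt s)"
    and Wt: "matrix_weight I (deformed_weight v Wt t)"
  defines "\<Delta> \<equiv> \<lambda>j. coeff (v s) j - coeff (v t) j"
  shows "norm (moment I (deformed_weight v Wt s) k - moment I (deformed_weight v Wt t) k
      + (\<Sum>j\<le>d. \<Delta> j *\<^sub>R moment I (deformed_weight v Wt t) (k + j)))
    \<le> (real CARD('n))\<^sup>2 * (\<Sum>j\<le>d. \<bar>\<Delta> j\<bar>)\<^sup>2 *
      (even_trace_moment I (deformed_weight v Wt s) (k + 2 * d) + even_trace_moment I (deformed_weight v Wt t) (k + 2 * d))"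
proof -
  define N where "N = (real CARD('n))\<^sup>2"
  define \<delta> where "\<delta> = (\<Sum>j\<le>d. \<bar>\<Delta> j\<bar>)"
  let ?A = "deformed_weight v Wt s" and ?B = "deformed_weight v Wt t"
  define f where "f x = indicator I x *\<^sub>R (x ^ k *\<^sub>R ?A x) - indicator I x *\<^sub>R (x ^ k *\<^sub>R ?B x)
      + (\<Sum>j\<le>d. \<Delta> j *\<^sub>R (indicator I x *\<^sub>R (x ^ (k + j) *\<^sub>R ?B x)))" for x
  define g where "g x = N * \<delta>\<^sup>2 * (indicator I x * ((1 + x\<^sup>2) ^ (k + 2 * d) * re_trace (?A x))
      + indicator I x * ((1 + x\<^sup>2) ^ (k + 2 * d) * re_trace (?B x)))" for x
  have f: "has_bochner_integral lborel f (moment I ?A k - moment I ?B k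
      + (\<Sum>j\<le>d. \<Delta> j *\<^sub>R moment I ?B (k + j)))"
    unfolding f_def moment_def set_lebesgue_integral_def
    by (intro has_bochner_integral_add has_bochner_integral_diff has_bochner_integral_sum
        has_bochner_integral_scaleR_right has_bochner_integral_integrable integrable_moment Ws Wt)
  have g: "has_bochner_integral lborel g
      (N * \<delta>\<^sup>2 * (even_trace_moment I ?A (k + 2 * d) + even_trace_moment I ?B (k + 2 * d)))"
    unfolding g_def
    by (intro has_bochner_integral_add has_bochner_integral_mult_right
        has_bochner_integral_even_trace_moment Ws Wt)
  have pd: "AE x in lborel. x \<in> I \<longrightarrow> pos_def (?A x)" "AE x in lborel. x \<in> I \<longrightarrow> pos_def (?B x)"
    using Ws Wt by (auto simp: matrix_weight_def)
  have le: "norm (f x) \<le> g x" if pdA: "pos_def (?A x)" and pdB: "pos_def (?B x)" and xI: "x \<in> I" for x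
  proof -
    define a where "a = poly (v s) x"
    define b where "b = poly (v t) x"
    have diff: "a - b = (\<Sum>j\<le>d. \<Delta> j * x ^ j)"
      unfolding a_def b_def poly_altdef deg \<Delta>_def by (simp add: sum_subtractf left_diff_distrib)
    have A: "?A x = exp (- a) *\<^sub>R Wt x" and B: "?B x = exp (- b) *\<^sub>R Wt x"
      by (simp_all add: deformed_weight_def a_def b_def)
    have "f x = (x ^ k * (exp (- a) - exp (- b) + (a - b) * exp (- b))) *\<^sub>R Wt x"
      unfolding f_def A B diff using xI
      by (simp add: power_add scaleR_add_left scaleR_diff_left distrib_left right_diff_distrib
          scaleR_sum_left sum_distrib_left sum_distrib_right mult_ac)
    then have "norm (f x) = \<bar>x\<bar> ^ k * \<bar>exp (- a) - exp (- b) + (a - b) * exp (- b)\<bar> * norm (Wt x)"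
      by (simp add: abs_mult power_abs)
    also have "\<dots> \<le> (1 + x\<^sup>2) ^ k * ((a - b)\<^sup>2 * (exp (- a) + exp (- b))) * norm (Wt x)"
      by (intro mult_mono exp_second_order_bound abs_power_le) auto
    also have "\<dots> = (1 + x\<^sup>2) ^ k * (a - b)\<^sup>2 * (norm (?A x) + norm (?B x))"
      by (simp add: A B algebra_simps)
    also have "\<dots> \<le> (1 + x\<^sup>2) ^ k * (\<delta> * (1 + x\<^sup>2) ^ d)\<^sup>2 * (N * re_trace (?A x) + N * re_trace (?B x))"
    proof (intro mult_mono add_mono)
      have "\<bar>a - b\<bar> \<le> (\<Sum>j\<le>d. \<bar>\<Delta> j\<bar> * (1 + x\<^sup>2) ^ d)"
        unfolding diff
      proof (intro order_trans[OF sum_abs] sum_mono)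
        fix j assume "j \<in> {..d}"
        then have "(1 + x\<^sup>2) ^ j \<le> (1 + x\<^sup>2) ^ d" by (intro power_increasing) auto
        then show "\<bar>\<Delta> j * x ^ j\<bar> \<le> \<bar>\<Delta> j\<bar> * (1 + x\<^sup>2) ^ d"
          unfolding abs_mult power_abs using abs_power_le[of x j] by (intro mult_left_mono) auto
      qed
      then show "(a - b)\<^sup>2 \<le> (\<delta> * (1 + x\<^sup>2) ^ d)\<^sup>2"
        by (simp add: \<delta>_def sum_distrib_right abs_le_square_iff[symmetric])
    qed (use pdA pdB in \<open>auto simp: N_def intro: pos_def_norm_le_re_trace\<close>)
    also have "\<dots> = g x"
      using xI by (simp add: g_def power_add power_mult power_mult_distrib power2_eq_square algebra_simps
          power_mult[of _ 2 d])
    finally show ?thesis .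
  qed
  have ae: "AE x in lborel. norm (f x) \<le> g x"
    using pd
  proof eventually_elim
    case (elim x)
    then show ?case
      using le[of x] by (cases "x \<in> I") (simp, simp add: f_def g_def)
  qed
  have fi: "integrable lborel f" and gi: "integrable lborel g"
    using f g by (auto intro: integrable.intros)
  have "norm (integral\<^sup>L lborel f) \<le> integral\<^sup>L lborel (\<lambda>x. norm (f x))"
    by (rule integral_norm_bound)
  also have "\<dots> \<le> integral\<^sup>L lborel g"
    by (intro integral_mono_AE ae gi integrable_norm fi)
  finally show ?thesis
    by (simp only: has_bochner_integral_integral_eq[OF f] has_bochner_integral_integral_eq[OF g] N_def \<delta>_def)
qed

text \<open>Formally this is differentiation under the integral sign. Domination is replaced by the
  second order bound: the sum of the \<open>\<bar>\<Delta> j\<bar>\<close> is \<open>O(s - t)\<close>, so the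
  remainder is \<open>o(s - t)\<close> as soon as the trace moments stay bounded near \<open>t\<close>, which follows from
  continuity of the moments.\<close>

lemma moment_has_vector_derivative:
  fixes I :: "real set" and Wt :: "real \<Rightarrow> 'n::finite cmat" and v :: "real \<Rightarrow> real poly"
  assumes deg: "\<And>s. s \<in> T \<Longrightarrow> degree (v s) = d"
    and W: "\<And>s. s \<in> T \<Longrightarrow> matrix_weight I (deformed_weight v Wt s)"
    and cont: "\<And>k. continuous_on T (\<lambda>s. moment I (deformed_weight v Wt s) k)"
    and v': "\<And>j. j \<le> d \<Longrightarrow> ((\<lambda>s. coeff (v s) j) has_real_derivative v' j) (at t within T)"
    and t: "t \<in> T"
  shows "((\<lambda>s. moment I (deformed_weight v Wt s) k) has_vector_derivative
      - (\<Sum>j\<le>d. v' j *\<^sub>R moment I (deformed_weight v Wt t) (k + j))) (at t within T)"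
proof -
  let ?S = "\<lambda>s k. moment I (deformed_weight v Wt s) k"
  let ?R = "\<lambda>s. even_trace_moment I (deformed_weight v Wt s) (k + 2 * d)"
  define \<Delta> where "\<Delta> s j = coeff (v s) j - coeff (v t) j" for s j
  define \<delta> where "\<delta> s = (\<Sum>j\<le>d. \<bar>\<Delta> s j\<bar>)" for s
  define r where "r s = ?S s k - ?S t k + (\<Sum>j\<le>d. \<Delta> s j *\<^sub>R ?S t (k + j))" for s
  define F where "F = at t within T"
  have inT: "\<forall>\<^sub>F s in F. s \<in> T" by (simp add: F_def eventually_at_filter)
  have quot: "((\<lambda>s. \<Delta> s j / (s - t)) \<longlongrightarrow> v' j) F" if "j \<le> d" for j
    using v'[OF that] by (simp add: has_field_derivative_iff \<Delta>_def F_def)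
  have \<Delta>0: "((\<lambda>s. \<Delta> s j) \<longlongrightarrow> 0) F" if "j \<le> d" for j
    using DERIV_continuous[OF v'[OF that]] unfolding \<Delta>_def F_def
    by (intro tendsto_diff[THEN tendsto_eq_rhs]) (auto simp: continuous_within)
  have R: "(?R \<longlongrightarrow> ?R t) F"
    unfolding even_trace_moment_def using cont t unfolding F_def
    by (intro tendsto_sum tendsto_mult tendsto_const bounded_linear.tendsto[OF bounded_linear_re_trace])
      (auto simp: continuous_on_def)
  have r0: "((\<lambda>s. r s /\<^sub>R (s - t)) \<longlongrightarrow> 0) F"
  proof (rule Lim_null_comparison)
    let ?b = "\<lambda>s. (real CARD('n))\<^sup>2 * (\<Sum>j\<le>d. \<bar>\<Delta> s j / (s - t)\<bar>) * \<delta> s * (?R s + ?R t)"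
    show "\<forall>\<^sub>F s in F. norm (r s /\<^sub>R (s - t)) \<le> ?b s"
      using inT
    proof eventually_elim
      case (elim s)
      have "norm (r s) \<le> (real CARD('n))\<^sup>2 * (\<delta> s)\<^sup>2 * (?R s + ?R t)"
        unfolding r_def \<delta>_def \<Delta>_def
        by (rule moment_second_order_bound[OF deg[OF elim] deg[OF t] W[OF elim] W[OF t]])
      then have "norm (r s) / \<bar>s - t\<bar> \<le> (real CARD('n))\<^sup>2 * (\<delta> s)\<^sup>2 * (?R s + ?R t) / \<bar>s - t\<bar>"
        by (rule divide_right_mono) simp
      also have "\<dots> = ?b s"
        by (simp add: \<delta>_def abs_divide sum_divide_distrib[symmetric] power2_eq_square)
      finally show ?case by (simp add: divide_inverse mult.commute)
    qed
    have "(?b \<longlongrightarrow> (real CARD('n))\<^sup>2 * (\<Sum>j\<le>d. \<bar>v' j\<bar>) * (\<Sum>j\<le>d. \<bar>0\<bar>) * (?R t + ?R t)) F"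
      unfolding \<delta>_def by (intro tendsto_intros quot \<Delta>0 R) auto
    then show "(?b \<longlongrightarrow> 0) F" by simp
  qed
  have "((\<lambda>s. r s /\<^sub>R (s - t) - (\<Sum>j\<le>d. (\<Delta> s j / (s - t)) *\<^sub>R ?S t (k + j)))
      \<longlongrightarrow> 0 - (\<Sum>j\<le>d. v' j *\<^sub>R ?S t (k + j))) F"
    by (intro tendsto_intros r0 quot) auto
  moreover have "r s /\<^sub>R (s - t) - (\<Sum>j\<le>d. (\<Delta> s j / (s - t)) *\<^sub>R ?S t (k + j)) = (?S s k - ?S t k) /\<^sub>R (s - t)" for s
    by (simp add: r_def scaleR_add_right scaleR_sum_right divide_inverse mult.commute)
  ultimately show ?thesis
    by (simp add: has_vector_derivative_iff_quotient F_def)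
qed

section \<open>Powers of the Jacobi operator\<close>

abbreviation Jacobi_power :: "(nat \<Rightarrow> 'n::finite cmat) \<Rightarrow> (nat \<Rightarrow> 'n cmat) \<Rightarrow> nat \<Rightarrow> 'n diffop" where
  "Jacobi_power B C k \<equiv> (op_comp (Jacobi_op B C) ^^ k) op_id"

lemma op_comp_Jacobi:
  "op_comp (Jacobi_op B C) M j n =
     M (j - 1) (Suc n) + B n ** M j n + C n ** zext (M (j + 1)) (int n - 1)"
proof -
  let ?J = "Jacobi_op B C"
  have "op_comp ?J M j n = (\<Sum>i\<in>{1, 0, -1}. ?J i n ** zext (M (j - i)) (int n + i))"
    unfolding op_comp_def
  proof (rule sum.mono_neutral_left)
    show "{i. ?J i \<noteq> (\<lambda>_. 0)} \<subseteq> {1, 0, -1}" by (auto simp: Jacobi_op_def split: if_splits)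
  qed (auto simp: cmat_mult.zero_left)
  then show ?thesis by (simp add: Jacobi_op_def zext_def nat_add_distrib)
qed

lemma Jacobi_power_Suc:
  "Jacobi_power B C (Suc k) j n = Jacobi_power B C k (j - 1) (Suc n)
     + B n ** Jacobi_power B C k j n + C n ** zext (Jacobi_power B C k (j + 1)) (int n - 1)"
  by (simp only: funpow.simps o_apply op_comp_Jacobi[of B C "Jacobi_power B C k"])

text \<open>A power of \<open>L\<close> has no entries that would refer to a negative index; this makes the formulas for
  \<open>n = 0\<close> and \<open>n = 1\<close> instances of the general ones.\<close>

lemma Jacobi_power_eq_0:
  assumes "int n + j < 0"
  shows "Jacobi_power B C k j n = 0"
  using assms
proof (induction k arbitrary: j n)
  case 0
  then show ?case by (simp add: op_id_def)
next
  case (Suc k)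
  have "Jacobi_power B C k (j - 1) (Suc n) = 0" "Jacobi_power B C k j n = 0"
    using Suc.prems by (auto intro!: Suc.IH)
  moreover have "zext (Jacobi_power B C k (j + 1)) (int n - 1) = 0"
    using Suc.prems by (auto simp: zext_def intro!: Suc.IH)
  ultimately show ?case unfolding Jacobi_power_Suc by (simp add: cmat_mult.zero_right)
qed

text \<open>The recurrence says that \<open>L\<close> acts on the sequence \<open>P\<close> as multiplication by \<open>x\<close>, hence \<open>L\<^sup>k\<close> as
  multiplication by \<open>x\<^sup>k\<close>. The sum runs over the target index \<open>m = n + j\<close> instead of the exponent \<open>j\<close> of
  the shift, so that it ranges over natural numbers.\<close>

lemma Jacobi_power_action:
  fixes P :: "nat \<Rightarrow> 'n::finite cmat"
  assumes rec: "\<And>n. x *\<^sub>R P n = P (Suc n) + B n ** P n + C n ** zext P (int n - 1)"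
    and N: "n + k \<le> N"
  shows "(\<Sum>m\<le>N. Jacobi_power B C k (int m - int n) n ** P m) = x ^ k *\<^sub>R P n"
  using N
proof (induction k arbitrary: n)
  case 0
  have "(\<Sum>m\<le>N. op_id (int m - int n) n ** P m) = (\<Sum>m\<le>N. if m = n then P n else 0)"
    by (intro sum.cong) (auto simp: op_id_def cmat_mult.zero_left)
  then show ?case using 0 by simp
next
  case (Suc k)
  let ?E = "\<lambda>n m. Jacobi_power B C k (int m - int n) n"
  have low: "(\<Sum>m\<le>N. zext (Jacobi_power B C k (int m - int n + 1)) (int n - 1) ** P m)
      = x ^ k *\<^sub>R zext P (int n - 1)"
  proof (cases n)
    case 0
    then show ?thesis by (simp add: zext_def cmat_mult.zero_left)
  next
    case (Suc i)
    then have "zext (Jacobi_power B C k (int m - int n + 1)) (int n - 1) = ?E i m" for m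
      by (simp add: zext_def)
    moreover have "(\<Sum>m\<le>N. ?E i m ** P m) = x ^ k *\<^sub>R P i"
      using Suc Suc.prems by (intro Suc.IH) simp
    ultimately show ?thesis using Suc by (simp add: zext_def)
  qed
  have "(\<Sum>m\<le>N. Jacobi_power B C (Suc k) (int m - int n) n ** P m) =
      (\<Sum>m\<le>N. ?E (Suc n) m ** P m) + B n ** (\<Sum>m\<le>N. ?E n m ** P m)
      + C n ** (\<Sum>m\<le>N. zext (Jacobi_power B C k (int m - int n + 1)) (int n - 1) ** P m)"
    unfolding Jacobi_power_Suc
    by (simp add: cmat_mult.add_left sum.distrib cmat_mult.sum_right matrix_mul_assoc
        diff_diff_eq add.commute)
  also have "\<dots> = x ^ k *\<^sub>R (P (Suc n) + B n ** P n + C n ** zext P (int n - 1))"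
    using Suc.IH[of "Suc n"] Suc.IH[of n] Suc.prems
    by (simp add: low scaleR_add_right cmat_mult.scaleR_right)
  finally show ?case by (simp add: rec[symmetric] mult.commute)
qed

section \<open>Derivatives of the coefficients of the orthogonal polynomials\<close>

lemma mip_power_MVOP:
  assumes W: "matrix_weight I W" and P: "monic_MVOP I W P"
    and rec: "\<And>n x. x *\<^sub>R P n x = P (Suc n) x + B n ** P n x + C n ** zext (\<lambda>m. P m x) (int n - 1)"
  shows "mip I W (\<lambda>x. x ^ j *\<^sub>R P n x) (P m)
    = Jacobi_power B C j (int m - int n) n ** mip I W (P m) (P m)"
proof -
  define N where "N = max m (n + j)"
  have "(\<lambda>x. x ^ j *\<^sub>R P n x) = (\<lambda>x. \<Sum>l\<le>N. Jacobi_power B C j (int l - int n) n ** P l x)"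
    by (intro ext Jacobi_power_action[symmetric] rec) (simp add: N_def)
  then show ?thesis
    using mip_MVOP_sum_left[OF W P, of "{..N}" _ m] by (simp add: N_def)
qed

lemma mip_monic:
  assumes W: "matrix_weight I W" and F: "monic_matrix_poly n F" and G: "monic_matrix_poly m G"
  shows "mip I W (\<lambda>x. x ^ r *\<^sub>R F x) G =
    (\<Sum>i\<le>n. \<Sum>l\<le>m. mcoeff n F i ** moment I W (r + i + l) ** conj_transpose (mcoeff m G l))"
  using mip_mpoly[OF W, of r n "mcoeff n F" m "mcoeff m G"]
  unfolding mcoeff_mpoly[OF F, symmetric] mcoeff_mpoly[OF G, symmetric] .

lemma coeff_recurrence:
  assumes P: "\<And>n. monic_matrix_poly n (P n)"
    and rec: "\<And>n x. x *\<^sub>R P n x = P (Suc n) x + B n ** P n x + C n ** zext (\<lambda>m. P m x) (int n - 1)"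
    and k: "k \<le> Suc n"
  shows "case_nat 0 (mcoeff n (P n)) k =
    mcoeff (Suc n) (P (Suc n)) k + B n ** mcoeff n (P n) k
    + C n ** zext (\<lambda>m. mcoeff m (P m) k) (int n - 1)"
proof (rule mpoly_coeffs_unique[OF _ k])
  fix x
  have ext: "P m x = mpoly (Suc n) (mcoeff m (P m)) x" if "m \<le> Suc n" for m
    using mcoeff_mpoly_extend[OF P that] .
  have z: "zext (\<lambda>m. P m x) (int n - 1) = mpoly (Suc n) (\<lambda>k. zext (\<lambda>m. mcoeff m (P m) k) (int n - 1)) x"
    by (cases n) (auto simp: zext_def ext mpoly_def)
  have "mpoly (Suc n) (case_nat 0 (mcoeff n (P n))) x = x *\<^sub>R P n x"
    using mcoeff_mpoly[OF P, of n] mpoly_shift[of x n "mcoeff n (P n)"] by metis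
  also have "\<dots> = mpoly (Suc n) (mcoeff (Suc n) (P (Suc n))) x
      + B n ** mpoly (Suc n) (mcoeff n (P n)) x
      + C n ** mpoly (Suc n) (\<lambda>k. zext (\<lambda>m. mcoeff m (P m) k) (int n - 1)) x"
    by (simp add: rec z flip: ext)
  finally show "mpoly (Suc n) (case_nat 0 (mcoeff n (P n))) x =
    mpoly (Suc n) (\<lambda>k. mcoeff (Suc n) (P (Suc n)) k + B n ** mcoeff n (P n) k
      + C n ** zext (\<lambda>m. mcoeff m (P m) k) (int n - 1)) x"
    by (simp add: mpoly_add mpoly_mult_left)
qed

lemma moment_form_regroup:
  fixes a X Y :: "nat \<Rightarrow> 'n::finite cmat" and b :: "nat \<Rightarrow> nat \<Rightarrow> 'n cmat"
  shows "(\<Sum>i\<le>n. a i ** (\<Sum>m<N. \<Sum>l\<le>m. X (i + l) ** (b m l ** Y m))) =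
    (\<Sum>m<N. (\<Sum>i\<le>n. \<Sum>l\<le>m. a i ** X (i + l) ** b m l) ** Y m)"
  by (simp add: cmat_mult.sum_right cmat_mult.sum_left matrix_mul_assoc) (rule sum.swap)

text \<open>Write \<open>P2 n - P n\<close> as a combination of the \<open>P m\<close> with \<open>m < n\<close>, with coefficients \<open>K m\<close>. Pairing with \<open>P m\<close>
  in \<open>W\<close> yields \<open>K m ** H m\<close> with \<open>H m\<close> the squared norm of \<open>P m\<close>, while pairing \<open>P2 n\<close> with
  \<open>P m\<close> in \<open>W2\<close> yields \<open>0\<close>; hence \<open>K m\<close> only involves differences of moments. The coefficients of
  \<open>P2\<close> occur on both sides, as \<open>perturbed_linear_system_derivative\<close> requires.\<close>

lemma MVOP_coeff_difference:
  assumes W: "matrix_weight I W" and P: "monic_MVOP I W P"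
    and W2: "matrix_weight I W2" and P2: "monic_MVOP I W2 P2"
    and H': "\<And>m. mip I W (P m) (P m) ** H' m = mat 1"
    and k: "k \<le> n"
  shows "mcoeff n (P2 n) k = mcoeff n (P n) k +
    (\<Sum>i\<le>n. mcoeff n (P2 n) i ** (\<Sum>m<n. \<Sum>l\<le>m. (moment I W (i + l) - moment I W2 (i + l)) **
        (conj_transpose (mcoeff m (P m) l) ** (H' m ** mcoeff m (P m) k))))"
proof -
  let ?a = "mcoeff n (P2 n)" and ?c = "\<lambda>m. mcoeff m (P m)"
  let ?M = "moment I W" and ?M2 = "moment I W2"
  note mono = MVOP_monic[OF W P] and mono2 = MVOP_monic[OF W2 P2]
  obtain K where K: "\<And>x. (\<Sum>k<n. x ^ k *\<^sub>R (?a k - ?c n k)) = (\<Sum>m<n. K m ** P m x)"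
    using expansion_in_monic_polys[OF mono, where a = "\<lambda>k. ?a k - ?c n k"] by blast
  have P2x: "P2 n x = P n x + (\<Sum>m<n. K m ** P m x)" for x
  proof -
    have "P2 n x = mpoly n ?a x" "P n x = mpoly n (?c n) x"
      using mcoeff_mpoly[OF mono2] mcoeff_mpoly[OF mono] by metis+
    then show ?thesis
      by (simp add: K[symmetric] mpoly_def lessThan_Suc_atMost[symmetric] mcoeff_lead[OF mono]
          mcoeff_lead[OF mono2] scaleR_diff_right sum_subtractf)
  qed
  have Kc: "?a k = ?c n k + (\<Sum>m<n. K m ** ?c m k)"
  proof (rule mpoly_coeffs_unique[OF _ k])
    fix x
    have ext: "P m x = mpoly n (?c m) x" if "m \<le> n" for m
      using mcoeff_mpoly_extend[OF mono that] .
    have "mpoly n ?a x = P2 n x" using mcoeff_mpoly[OF mono2, of n] by metis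
    also have "\<dots> = mpoly n (?c n) x + (\<Sum>m<n. K m ** mpoly n (?c m) x)"
      by (simp add: P2x ext)
    also have "\<dots> = mpoly n (\<lambda>k. ?c n k + (\<Sum>m<n. K m ** ?c m k)) x"
      unfolding mpoly_mult_left unfolding mpoly_def
      by (simp add: sum.distrib scaleR_add_right scaleR_sum_right) (rule sum.swap)
    finally show "mpoly n ?a x = mpoly n (\<lambda>k. ?c n k + (\<Sum>m<n. K m ** ?c m k)) x" .
  qed
  have Km: "K m = (\<Sum>i\<le>n. \<Sum>l\<le>m. ?a i ** (?M (i + l) - ?M2 (i + l)) ** conj_transpose (?c m l)) ** H' m"
    if m: "m < n" for m
  proof -
    have "P2 n = (\<lambda>x. \<Sum>l\<in>{..n}. (K(n := mat 1)) l ** P l x)"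
      by (intro ext) (simp add: P2x lessThan_Suc_atMost[symmetric] add.commute)
    then have "mip I W (P2 n) (P m) = K m ** mip I W (P m) (P m)"
      using m mip_MVOP_sum_left[OF W P, of "{..n}" "K(n := mat 1)" m] by simp
    moreover have "mip I W2 (P2 n) (P m) = 0"
      using MVOP_orthogonal_mpoly[OF W2 P2 m, of "?c m"]
      unfolding mcoeff_mpoly[OF mono, of m, symmetric] .
    ultimately have "K m ** mip I W (P m) (P m) = mip I W (P2 n) (P m) - mip I W2 (P2 n) (P m)"
      by simp
    also have "\<dots> = (\<Sum>i\<le>n. \<Sum>l\<le>m. ?a i ** (?M (i + l) - ?M2 (i + l)) ** conj_transpose (?c m l))"
      using mip_monic[OF W mono2 mono, of 0 n m] mip_monic[OF W2 mono2 mono, of 0 n m]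
      by (simp add: cmat_mult.diff_left cmat_mult.diff_right sum_subtractf)
    finally have "K m ** mip I W (P m) (P m) =
        (\<Sum>i\<le>n. \<Sum>l\<le>m. ?a i ** (?M (i + l) - ?M2 (i + l)) ** conj_transpose (?c m l))" .
    moreover have "K m = K m ** mip I W (P m) (P m) ** H' m"
      by (simp add: H' flip: matrix_mul_assoc)
    ultimately show ?thesis by simp
  qed
  have "?a k = ?c n k + (\<Sum>m<n. (\<Sum>i\<le>n. \<Sum>l\<le>m. ?a i ** (?M (i + l) - ?M2 (i + l))
      ** conj_transpose (?c m l)) ** (H' m ** ?c m k))"
    unfolding Kc by (simp add: Km matrix_mul_assoc)
  then show ?thesis
    by (simp only: moment_form_regroup[where X = "\<lambda>r. ?M r - ?M2 r"])
qed

text \<open>In terms of polynomials: the derivative of \<open>P n\<close> in \<open>t\<close> is the sum of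
  \<open>V\<^sub>m\<^sub>-\<^sub>n(n) ** P m\<close> over \<open>m < n\<close>, where \<open>V\<close> is \<open>\<partial>\<^sub>t v\<close> evaluated at \<open>L\<close>. The derivative of the
  perturbation \<open>G\<close> reproduces the pairing of \<open>\<partial>\<^sub>t v * P n\<close> with \<open>P m\<close>, which by \<open>mip_power_MVOP\<close> equals
  \<open>V\<^sub>m\<^sub>-\<^sub>n(n) ** H m\<close>, and the factor \<open>H m\<close> cancels.\<close>

lemma MVOP_coeff_has_vector_derivative:
  fixes I :: "real set" and Wt :: "real \<Rightarrow> 'n::finite cmat" and v :: "real \<Rightarrow> real poly"
  assumes deg: "\<And>s. s \<in> T \<Longrightarrow> degree (v s) = d"
    and W: "\<And>s. s \<in> T \<Longrightarrow> matrix_weight I (deformed_weight v Wt s)"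
    and cont: "\<And>k. continuous_on T (\<lambda>s. moment I (deformed_weight v Wt s) k)"
    and v': "\<And>j. j \<le> d \<Longrightarrow> ((\<lambda>s. coeff (v s) j) has_real_derivative v' j) (at t within T)"
    and t: "t \<in> T"
    and P: "\<And>s. s \<in> T \<Longrightarrow> monic_MVOP I (deformed_weight v Wt s) (P s)"
    and rec: "\<And>n x. x *\<^sub>R P t n x = P t (Suc n) x + B n ** P t n x
       + C n ** zext (\<lambda>m. P t m x) (int n - 1)"
    and k: "k \<le> n"
  shows "((\<lambda>s. mcoeff n (P s n) k) has_vector_derivative
      (\<Sum>m<n. (\<Sum>j\<le>d. v' j *\<^sub>R Jacobi_power B C j (int m - int n) n) ** mcoeff m (P t m) k))
    (at t within T)"
proof -
  let ?S = "\<lambda>s. moment I (deformed_weight v Wt s)" and ?c = "\<lambda>m. mcoeff m (P t m)"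
  let ?H = "\<lambda>m. mip I (deformed_weight v Wt t) (P t m) (P t m)"
  have "\<exists>H'. ?H m ** H' = mat 1" for m
  proof -
    have "pos_def (?H m)" using P[OF t] by (simp add: monic_MVOP_def)
    then show ?thesis by (rule pos_def_right_inverse) blast
  qed
  then obtain H' where H': "\<And>m. ?H m ** H' m = mat 1" by metis
  define Y where "Y k m = H' m ** ?c m k" for k m
  define G where "G i k s = (\<Sum>m<n. \<Sum>l\<le>m. (?S t (i + l) - ?S s (i + l)) **
      (conj_transpose (?c m l) ** Y k m))" for i k s
  define S' where "S' r = (\<Sum>j\<le>d. v' j *\<^sub>R ?S t (r + j))" for r
  define G' where "G' i k = (\<Sum>m<n. \<Sum>l\<le>m. S' (i + l) ** (conj_transpose (?c m l) ** Y k m))" for i k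
  have "((\<lambda>s. mcoeff n (P s n) k) has_vector_derivative (\<Sum>i\<le>n. ?c n i ** G' i k)) (at t within T)"
  proof (rule perturbed_linear_system_derivative[OF _ _ _ k t])
    show "mcoeff n (P s n) k = ?c n k + (\<Sum>i\<le>n. mcoeff n (P s n) i ** G i k s)"
      if s: "s \<in> T" and k: "k \<le> n" for s k
      unfolding G_def Y_def by (rule MVOP_coeff_difference[OF W[OF t] P[OF t] W[OF s] P[OF s] H' k])
    show "G i k t = 0" for i k by (simp add: G_def cmat_mult.zero_left)
    have "((\<lambda>s. ?S t r - ?S s r) has_vector_derivative S' r) (at t within T)" for r
    proof -
      have "((\<lambda>s. ?S t r - ?S s r) has_vector_derivative 0 - - S' r) (at t within T)"
        unfolding S'_def
        by (intro has_vector_derivative_diff has_vector_derivative_const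
            moment_has_vector_derivative[OF deg W cont v' t])
      then show ?thesis by simp
    qed
    then show "(G i k has_vector_derivative G' i k) (at t within T)" for i k
      unfolding G_def G'_def
      by (intro has_vector_derivative_sum bounded_linear.has_vector_derivative[OF cmat_mult.bounded_linear_left])
  qed
  also have "(\<Sum>i\<le>n. ?c n i ** G' i k) =
      (\<Sum>m<n. (\<Sum>i\<le>n. \<Sum>l\<le>m. ?c n i ** S' (i + l) ** conj_transpose (?c m l)) ** Y k m)"
    unfolding G'_def by (rule moment_form_regroup)
  also have "\<dots> = (\<Sum>m<n. (\<Sum>j\<le>d. v' j *\<^sub>R Jacobi_power B C j (int m - int n) n) ** ?c m k)"
  proof (intro sum.cong refl)
    fix m
    note mono = MVOP_monic[OF W[OF t] P[OF t]]
    have "(\<Sum>i\<le>n. \<Sum>l\<le>m. ?c n i ** S' (i + l) ** conj_transpose (?c m l)) =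
        (\<Sum>j\<le>d. v' j *\<^sub>R (\<Sum>i\<le>n. \<Sum>l\<le>m. ?c n i ** ?S t (j + i + l) ** conj_transpose (?c m l)))"
      unfolding S'_def
      by (simp add: cmat_mult.sum_left cmat_mult.sum_right cmat_mult.scaleR_left cmat_mult.scaleR_right
          scaleR_sum_right sum.swap[of _ "{..d}"] add_ac)
    also have "\<dots> = (\<Sum>j\<le>d. v' j *\<^sub>R Jacobi_power B C j (int m - int n) n) ** ?H m"
    proof -
      have "(\<Sum>i\<le>n. \<Sum>l\<le>m. ?c n i ** ?S t (j + i + l) ** conj_transpose (?c m l))
        = Jacobi_power B C j (int m - int n) n ** ?H m" for j
        using mip_power_MVOP[OF W[OF t] P[OF t] rec, of j n m]
          mip_monic[OF W[OF t] mono mono, of j n m] by (simp only:)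
      then show ?thesis by (simp add: cmat_mult.sum_left cmat_mult.scaleR_left)
    qed
    finally have "(\<Sum>i\<le>n. \<Sum>l\<le>m. ?c n i ** S' (i + l) ** conj_transpose (?c m l)) ** Y k m =
       (\<Sum>j\<le>d. v' j *\<^sub>R Jacobi_power B C j (int m - int n) n) ** (?H m ** H' m) ** ?c m k"
      by (simp only: Y_def matrix_mul_assoc)
    then show "(\<Sum>i\<le>n. \<Sum>l\<le>m. ?c n i ** S' (i + l) ** conj_transpose (?c m l)) ** Y k m =
       (\<Sum>j\<le>d. v' j *\<^sub>R Jacobi_power B C j (int m - int n) n) ** ?c m k"
      by (simp only: H' matrix_mul_rid)
  qed
  finally show ?thesis .
qed

section \<open>The deformation equations\<close>

text \<open>The coefficient of \<open>x\<^sup>n\<^sup>-\<^sup>j\<close> in \<open>P n\<close>, with value \<open>0\<close> when the exponent would be negative.\<close>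

definition subleading :: "(nat \<Rightarrow> real \<Rightarrow> 'n::finite cmat) \<Rightarrow> nat \<Rightarrow> nat \<Rightarrow> 'n cmat" where
  "subleading P j n = (if j \<le> n then mcoeff n (P n) (n - j) else 0)"

text \<open>These are the coefficients of \<open>x\<^sup>n\<close> in the recurrence for \<open>x P n\<close> and in the one for
  \<open>x P (n + 1)\<close>.\<close>

lemma
  assumes P: "\<And>n. monic_matrix_poly n (P n)"
    and rec: "\<And>n x. x *\<^sub>R P n x = P (Suc n) x + B n ** P n x + C n ** zext (\<lambda>m. P m x) (int n - 1)"
  shows B_eq_subleading: "B n = subleading P 1 n - subleading P 1 (Suc n)"
    and C_eq_subleading: "C (Suc n) = subleading P 2 (Suc n) - subleading P 2 (Suc (Suc n))
      - B (Suc n) ** subleading P 1 (Suc n)"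
proof -
  note lead = mcoeff_lead[OF P]
  have z: "zext (\<lambda>m. mcoeff m (P m) n) (int n - 1) = 0"
    by (cases n) (auto simp: zext_def mcoeff_above)
  show "B n = subleading P 1 n - subleading P 1 (Suc n)"
    using coeff_recurrence[OF P rec, of n n] z
    by (cases n) (auto simp: subleading_def lead cmat_mult.zero_right eq_neg_iff_add_eq_0 add.commute)
  show "C (Suc n) = subleading P 2 (Suc n) - subleading P 2 (Suc (Suc n)) - B (Suc n) ** subleading P 1 (Suc n)"
    using coeff_recurrence[OF P rec, of n "Suc n"]
    by (cases n) (auto simp: subleading_def lead zext_def algebra_simps numeral_2_eq_2 nat_add_distrib
        eq_neg_iff_add_eq_0)
qed

theorem theorem7p1:
  fixes I :: "real set"
    and Wt :: "real \<Rightarrow> complex^'n::finite^'n"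
    and v :: "real \<Rightarrow> real poly"
    and d :: nat
    and P :: "real \<Rightarrow> nat \<Rightarrow> real \<Rightarrow> complex^'n^'n"
    and B C :: "real \<Rightarrow> nat \<Rightarrow> complex^'n^'n"
  assumes v_degree: "even d" "\<And>t. t \<ge> 0 \<Longrightarrow> degree (v t) = d"
    and v_lead: "\<And>t. t \<ge> 0 \<Longrightarrow> lead_coeff (v t) > 0"
    and v_smooth: "\<And>k. smooth_nonneg (\<lambda>t. coeff (v t) k)"
    and weight: "\<And>t. t \<ge> 0 \<Longrightarrow> matrix_weight I (deformed_weight v Wt t)"
    and moments_cont: "\<And>k. continuous_on {0..} (\<lambda>t. moment I (deformed_weight v Wt t) k)"
    and mvop: "\<And>t. t \<ge> 0 \<Longrightarrow> monic_MVOP I (deformed_weight v Wt t) (P t)"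
    and C_zero: "\<And>t. t \<ge> 0 \<Longrightarrow> C t 0 = 0"
    and recurrence: "\<And>t n x. t \<ge> 0 \<Longrightarrow>
      x *\<^sub>R P t n x = P t (Suc n) x + B t n ** P t n x
        + C t n ** zext (\<lambda>m. P t m x) (int n - 1)"
  shows "\<forall>t\<ge>0. \<forall>n.
    ((\<lambda>s. B s n) has_vector_derivative
        op_poly (poly_dot v t) (Jacobi_op (B t) (C t)) (-1) n
      - op_poly (poly_dot v t) (Jacobi_op (B t) (C t)) (-1) (n + 1)) (at t within {0..}) \<and>
    ((\<lambda>s. C s n) has_vector_derivative
        op_poly (poly_dot v t) (Jacobi_op (B t) (C t)) (-2) n
      - op_poly (poly_dot v t) (Jacobi_op (B t) (C t)) (-2) (n + 1)
      + op_poly (poly_dot v t) (Jacobi_op (B t) (C t)) (-1) n ** zext (B t) (int n - 1)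
      - B t n ** op_poly (poly_dot v t) (Jacobi_op (B t) (C t)) (-1) n) (at t within {0..})"
proof (intro allI impI)
  fix t :: real and n :: nat
  assume t: "t \<ge> 0"
  then have tT: "t \<in> {0..}" by simp
  have "\<exists>D. ((\<lambda>s. coeff (v s) k) has_real_derivative D) (at t within {0..})" for k
    using v_smooth[of k] t unfolding smooth_nonneg_def by metis
  then obtain v' where v': "\<And>k. ((\<lambda>s. coeff (v s) k) has_real_derivative v' k) (at t within {0..})"
    by metis
  define p where "p = (\<Sum>j\<le>d. monom (v' j) j)"
  have coeff_p: "coeff p k = (if k \<le> d then v' k else 0)" for k
    by (simp add: p_def coeff_sum)
  have deg_p: "degree p \<le> d"
    by (rule degree_le) (simp add: coeff_p)
  have dot: "poly_dot v t = p"
  proof (rule poly_dot_eqI[OF t _ deg_p])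
    show "\<forall>s\<ge>0. degree (v s) = d" using v_degree by simp
    show "((\<lambda>s. coeff (v s) k) has_real_derivative coeff p k) (at t within {0..})" for k
    proof (cases "k \<le> d")
      case False
      then have "((\<lambda>s. coeff (v s) k) has_real_derivative 0) (at t within {0..})"
        using v_degree(2)
        by (intro has_field_derivative_transform_within[OF DERIV_const zero_less_one tT])
          (simp add: coeff_eq_0)
      then show ?thesis using False by (simp add: coeff_p)
    qed (simp add: coeff_p v')
  qed
  define V where "V j n = op_poly (poly_dot v t) (Jacobi_op (B t) (C t)) j n" for j n
  have V: "V j n = (\<Sum>k\<le>d. v' k *\<^sub>R Jacobi_power (B t) (C t) k j n)" for j n
  proof -
    have "V j n = (\<Sum>k\<le>d. coeff p k *\<^sub>R Jacobi_power (B t) (C t) k j n)"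
      unfolding V_def op_poly_def dot
      by (rule sum.mono_neutral_left) (use deg_p in \<open>auto simp: coeff_eq_0\<close>)
    then show ?thesis by (simp add: coeff_p)
  qed
  have V0: "V j n = 0" if "int n + j < 0" for j n
    by (simp only: V Jacobi_power_eq_0[OF that] scaleR_zero_right sum.neutral_const)
  have mono: "monic_matrix_poly n (P s n)" if "s \<ge> 0" for s n
    using mvop[OF that] by (simp add: monic_MVOP_def)
  note lead = mcoeff_lead[OF mono[OF t]]
  have coeff': "((\<lambda>s. mcoeff n (P s n) k) has_vector_derivative
      (\<Sum>m<n. V (int m - int n) n ** mcoeff m (P t m) k)) (at t within {0..})" if "k \<le> n" for n k
    unfolding V
    by (rule MVOP_coeff_has_vector_derivative[OF _ _ moments_cont v' tT _ _ that])
      (use v_degree weight mvop recurrence t in auto)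
  \<comment> \<open>In the coefficients of \<open>x\<^sup>n\<^sup>-\<^sup>1\<close> and \<open>x\<^sup>n\<^sup>-\<^sup>2\<close> only the summands \<open>m \<ge> n - 1\<close> and
    \<open>m \<ge> n - 2\<close> survive, since \<open>P m\<close> has degree \<open>m\<close>.\<close>
  define p1 where "p1 s n = subleading (P s) 1 n" for s n
  define p2 where "p2 s n = subleading (P s) 2 n" for s n
  have p1': "((\<lambda>s. p1 s n) has_vector_derivative V (-1) n) (at t within {0..})" for n
  proof (cases n)
    case 0
    then show ?thesis by (simp add: p1_def subleading_def V0)
  next
    case (Suc i)
    have "(\<Sum>m<n. V (int m - int n) n ** mcoeff m (P t m) i) = V (-1) n"
      using Suc by (simp add: mcoeff_above cmat_mult.zero_right lead)
    then show ?thesis using coeff'[of i n] Suc by (simp add: p1_def subleading_def)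
  qed
  have p2': "((\<lambda>s. p2 s (Suc n)) has_vector_derivative V (-2) (Suc n) + V (-1) (Suc n) ** p1 t n)
      (at t within {0..})" for n
  proof (cases n)
    case 0
    then show ?thesis by (simp add: p1_def p2_def subleading_def V0 cmat_mult.zero_right)
  next
    case (Suc i)
    have "(\<Sum>m<Suc n. V (int m - int (Suc n)) (Suc n) ** mcoeff m (P t m) i) =
        V (-2) (Suc n) + V (-1) (Suc n) ** p1 t n"
      using Suc by (simp add: mcoeff_above cmat_mult.zero_right lead p1_def subleading_def)
    then show ?thesis using coeff'[of i "Suc n"] Suc by (simp add: p2_def subleading_def)
  qed
  have Beq: "B s n = p1 s n - p1 s (Suc n)" if "s \<ge> 0" for s n
    unfolding p1_def by (rule B_eq_subleading[OF mono[OF that] recurrence[OF that]])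
  have Ceq: "C s (Suc n) = p2 s (Suc n) - p2 s (Suc (Suc n)) - B s (Suc n) ** p1 s (Suc n)"
    if "s \<ge> 0" for s n
    unfolding p1_def p2_def by (rule C_eq_subleading[OF mono[OF that] recurrence[OF that]])
  have B': "((\<lambda>s. B s n) has_vector_derivative V (-1) n - V (-1) (Suc n)) (at t within {0..})" for n
    by (rule has_vector_derivative_transform[OF tT _ has_vector_derivative_diff[OF p1' p1']])
      (simp add: Beq)
  have C': "((\<lambda>s. C s n) has_vector_derivative V (-2) n - V (-2) (Suc n)
      + V (-1) n ** zext (B t) (int n - 1) - B t n ** V (-1) n) (at t within {0..})"
  proof (cases n)
    case 0
    have "((\<lambda>s. C s 0) has_vector_derivative 0) (at t within {0..})"
      by (rule has_vector_derivative_transform[OF tT _ has_vector_derivative_const])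
        (simp add: C_zero)
    then show ?thesis using 0 by (simp add: V0 cmat_mult.zero_left cmat_mult.zero_right)
  next
    case (Suc i)
    let ?D = "(V (-2) n + V (-1) n ** p1 t i) - (V (-2) (Suc n) + V (-1) (Suc n) ** p1 t n)
        - (B t n ** V (-1) n + (V (-1) n - V (-1) (Suc n)) ** p1 t n)"
    have "((\<lambda>s. p2 s n - p2 s (Suc n) - B s n ** p1 s n) has_vector_derivative ?D) (at t within {0..})"
      by (intro has_vector_derivative_diff cmat_mult.has_vector_derivative B' p1' p2'
          p2'[of i, folded Suc])
    then have "((\<lambda>s. C s n) has_vector_derivative ?D) (at t within {0..})"
      by (rule has_vector_derivative_transform[OF tT, rotated]) (simp add: Suc Ceq)
    also have "?D = V (-2) n - V (-2) (Suc n) + V (-1) n ** zext (B t) (int n - 1) - B t n ** V (-1) n"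
      using Suc t by (simp add: zext_def Beq[of t i] cmat_mult.diff_left cmat_mult.diff_right)
    finally show ?thesis .
  qed
  show "((\<lambda>s. B s n) has_vector_derivative
        op_poly (poly_dot v t) (Jacobi_op (B t) (C t)) (-1) n
      - op_poly (poly_dot v t) (Jacobi_op (B t) (C t)) (-1) (n + 1)) (at t within {0..}) \<and>
    ((\<lambda>s. C s n) has_vector_derivative
        op_poly (poly_dot v t) (Jacobi_op (B t) (C t)) (-2) n
      - op_poly (poly_dot v t) (Jacobi_op (B t) (C t)) (-2) (n + 1)
      + op_poly (poly_dot v t) (Jacobi_op (B t) (C t)) (-1) n ** zext (B t) (int n - 1)
      - B t n ** op_poly (poly_dot v t) (Jacobi_op (B t) (C t)) (-1) n) (at t within {0..})"
    using B'[of n] C' by (simp add: V_def)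
qed

end
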